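(* Let $f\in\mathrm{Diff}(\mathbb{S}^1)$ have exactly two fixed points $N$ and $S$. Then $f$ is area-preserving if and only if it is spectrally Möbius-like, i.e. if and only if $f'(N)f'(S)=1$ and $f'(N)\neq 1$.
   Context: $\mathrm{Diff}(\mathbb{S}^1)$ is the group of orientation-preserving $C^\infty$ diffeomorphisms of $\mathbb{S}^1$. $f$ is area-preserving if the diagonal map $(x,y)\mapsto(f(x),f(y))$ preserves a smooth (nowhere vanishing) volume form on $\mathcal{C}=\mathbb{S}^1\times\mathbb{S}^1\setminus\Delta$, where $\Delta$ is the diagonal. A representation $\rho:\Gamma\to\mathrm{Diff}(\mathbb{S}^1)$ is spectrally Möbius-like if non trivial elements have at most two fixed points, and if elements $\gamma$ with two fixed points $N,S$ satisfy $\rho(\gamma)'(N)\rho(\gamma)'(S)=1$ and $\rho(\gamma)'(N)\neq 1$; for a single diffeomorphism $f$ this is applied to the representation of $\mathbb{Z}$ it generates. *)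

theory Defs
  imports
    "HOL-Analysis.Analysis"
    "HOL-Algebra.Bij"
    "HOL-Algebra.Elementary_Groups"
begin

section \<open>Smooth maps between normed vector spaces\<close>

text \<open>For open \<open>U\<close> in a finite-dimensional space this is the usual notion of a map of class
  \<open>C\<^sup>n\<close>: all iterated directional derivatives up to order \<open>n\<close> exist and are continuous.\<close>

primrec times_differentiable_on ::
    "nat \<Rightarrow> ('a::real_normed_vector \<Rightarrow> 'b::real_normed_vector) \<Rightarrow> 'a set \<Rightarrow> bool" where
  "times_differentiable_on 0 f U \<longleftrightarrow> continuous_on U f"
| "times_differentiable_on (Suc n) f U \<longleftrightarrow>
     (\<forall>x\<in>U. f differentiable (at x)) \<and>
     (\<forall>v. times_differentiable_on n (\<lambda>x. frechet_derivative f (at x) v) U)"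

definition smooth_on ::
    "('a::real_normed_vector \<Rightarrow> 'b::real_normed_vector) \<Rightarrow> 'a set \<Rightarrow> bool" where
  "smooth_on f U \<longleftrightarrow> (\<forall>n. times_differentiable_on n f U)"

section \<open>The circle and its diffeomorphisms\<close>

abbreviation S1 :: "complex set" where
  "S1 \<equiv> sphere 0 1"

text \<open>Since \<open>cis\<close> is a local diffeomorphism onto the circle, which is an embedded submanifold of
  the plane, a self-map \<open>f\<close> of the circle is smooth iff \<open>\<lambda>t. f (cis t)\<close> is smooth as a planar curve.\<close>

definition smooth_circle_map :: "(complex \<Rightarrow> complex) \<Rightarrow> bool" where
  "smooth_circle_map f \<longleftrightarrow> f ` S1 \<subseteq> S1 \<and> smooth_on (\<lambda>t::real. f (cis t)) UNIV"

text \<open>The tangent line at \<open>x\<close> is \<open>\<real> \<cdot> (\<i> * x)\<close>, and the vector \<open>a *\<^sub>R (\<i> * x)\<close> is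
  the velocity at time \<open>0\<close> of the curve \<open>\<lambda>t. x * cis (a * t)\<close>.\<close>

definition tangent_circle :: "complex \<Rightarrow> complex set" where
  "tangent_circle x = range (\<lambda>a::real. a *\<^sub>R (\<i> * x))"

definition circle_differential :: "(complex \<Rightarrow> complex) \<Rightarrow> complex \<Rightarrow> complex \<Rightarrow> complex" where
  "circle_differential f x v =
     Re (v / (\<i> * x)) *\<^sub>R vector_derivative (\<lambda>t::real. f (x * cis t)) (at 0)"

text \<open>The derivative \<open>f'(x)\<close> with respect to the angular coordinate: the real number \<open>r\<close> such that
  the differential of \<open>f\<close> maps \<open>\<i> * x\<close> to \<open>r *\<^sub>R (\<i> * f x)\<close>. The quotient below is already real
  for smooth self-maps of the circle.\<close>

definition circle_deriv :: "(complex \<Rightarrow> complex) \<Rightarrow> complex \<Rightarrow> real" where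
  "circle_deriv f x = Re (circle_differential f x (\<i> * x) / (\<i> * f x))"

text \<open>Elements of \<open>Bij S1\<close> are extensional, i.e. \<open>undefined\<close> off the circle, so that
  equality of elements is equality of maps on the circle.\<close>

definition Diff_S1 :: "(complex \<Rightarrow> complex) set" where
  "Diff_S1 = {f \<in> Bij S1. smooth_circle_map f \<and> smooth_circle_map (inv_into S1 f) \<and>
                          (\<forall>x\<in>S1. circle_deriv f x > 0)}"

definition fixed_points :: "(complex \<Rightarrow> complex) \<Rightarrow> complex set" where
  "fixed_points f = {x \<in> S1. f x = x}"

section \<open>Volume forms on the complement of the diagonal\<close>

definition off_diagonal :: "(complex \<times> complex) set" where
  "off_diagonal = {(x, y). x \<in> S1 \<and> y \<in> S1 \<and> x \<noteq> y}"

definition tangent_off_diagonal :: "complex \<times> complex \<Rightarrow> (complex \<times> complex) set" where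
  "tangent_off_diagonal p = tangent_circle (fst p) \<times> tangent_circle (snd p)"

text \<open>A 2-form is a function \<open>\<omega>\<close> of a base point and two tangent vectors, whose values matter
  only at points of \<open>off_diagonal\<close> and vectors tangent to it there.\<close>

type_synonym two_form =
  "complex \<times> complex \<Rightarrow> complex \<times> complex \<Rightarrow> complex \<times> complex \<Rightarrow> real"

definition alternating_two_form :: "two_form \<Rightarrow> bool" where
  "alternating_two_form \<omega> \<longleftrightarrow>
     (\<forall>p\<in>off_diagonal. \<forall>u\<in>tangent_off_diagonal p. \<forall>v\<in>tangent_off_diagonal p.
        \<omega> p v u = - \<omega> p u v \<and>
        (\<forall>w\<in>tangent_off_diagonal p. \<forall>a b.
           \<omega> p (a *\<^sub>R u + b *\<^sub>R v) w = a * \<omega> p u w + b * \<omega> p v w))"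

text \<open>Smoothness of the coefficient of \<open>\<omega>\<close> in the frame of angular coordinate vector fields.\<close>

definition smooth_two_form :: "two_form \<Rightarrow> bool" where
  "smooth_two_form \<omega> \<longleftrightarrow>
     smooth_on (\<lambda>(s::real, t::real). \<omega> (cis s, cis t) (\<i> * cis s, 0) (0, \<i> * cis t))
               {(s, t). cis s \<noteq> cis t}"

definition smooth_volume_form :: "two_form \<Rightarrow> bool" where
  "smooth_volume_form \<omega> \<longleftrightarrow> alternating_two_form \<omega> \<and> smooth_two_form \<omega> \<and>
     (\<forall>p\<in>off_diagonal. \<exists>u\<in>tangent_off_diagonal p. \<exists>v\<in>tangent_off_diagonal p. \<omega> p u v \<noteq> 0)"

definition diagonal_differential ::
    "(complex \<Rightarrow> complex) \<Rightarrow> complex \<times> complex \<Rightarrow> complex \<times> complex \<Rightarrow> complex \<times> complex" where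
  "diagonal_differential f p v =
     (circle_differential f (fst p) (fst v), circle_differential f (snd p) (snd v))"

text \<open>Invariance under pullback by the diagonal map \<open>map_prod f f\<close>.\<close>

definition diagonal_preserves :: "(complex \<Rightarrow> complex) \<Rightarrow> two_form \<Rightarrow> bool" where
  "diagonal_preserves f \<omega> \<longleftrightarrow>
     (\<forall>p\<in>off_diagonal. \<forall>u\<in>tangent_off_diagonal p. \<forall>v\<in>tangent_off_diagonal p.
        \<omega> (map_prod f f p) (diagonal_differential f p u) (diagonal_differential f p v) = \<omega> p u v)"

definition area_preserving :: "(complex \<Rightarrow> complex) \<Rightarrow> bool" where
  "area_preserving f \<longleftrightarrow> (\<exists>\<omega>. smooth_volume_form \<omega> \<and> diagonal_preserves f \<omega>)"

section \<open>Spectrally Moebius-like representations\<close>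

definition spectrally_moebius_like ::
    "('g, 'm) monoid_scheme \<Rightarrow> ('g \<Rightarrow> complex \<Rightarrow> complex) \<Rightarrow> bool" where
  "spectrally_moebius_like \<Gamma> \<rho> \<longleftrightarrow>
     (\<forall>\<gamma>\<in>carrier \<Gamma>. \<gamma> \<noteq> \<one>\<^bsub>\<Gamma>\<^esub> \<longrightarrow>
        finite (fixed_points (\<rho> \<gamma>)) \<and> card (fixed_points (\<rho> \<gamma>)) \<le> 2) \<and>
     (\<forall>\<gamma>\<in>carrier \<Gamma>. \<forall>N S. N \<noteq> S \<and> fixed_points (\<rho> \<gamma>) = {N, S} \<longrightarrow>
        circle_deriv (\<rho> \<gamma>) N * circle_deriv (\<rho> \<gamma>) S = 1 \<and> circle_deriv (\<rho> \<gamma>) N \<noteq> 1)"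

text \<open>The representation of \<open>\<int>\<close> generated by \<open>f\<close>; powers are iterates of \<open>f\<close> and of its inverse.\<close>

definition generated_rep :: "(complex \<Rightarrow> complex) \<Rightarrow> int \<Rightarrow> complex \<Rightarrow> complex" where
  "generated_rep f n = f [^]\<^bsub>BijGroup S1\<^esub> n"

lemma generated_rep_hom:
  assumes "f \<in> Diff_S1"
  shows "generated_rep f \<in> hom integer_group (BijGroup S1)"
proof -
  interpret group "BijGroup S1" by (rule group_BijGroup)
  have "f \<in> carrier (BijGroup S1)"
    using assms by (simp add: Diff_S1_def BijGroup_def)
  then show ?thesis
    unfolding generated_rep_def by (rule hom_integer_group_pow)
qed

end

theory Submission
  imports Defs
begin

text \<open>
  In the angular coordinates \<open>s\<close>, \<open>t\<close> an invariant volume form is a nowhere vanishing density \<open>w\<close>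
  off the diagonal with \<open>w (F s) (F t) * F' s * F' t = w s t\<close>, where \<open>F\<close> is a lift of \<open>f\<close> to the
  line (\<open>density_imp_area_preserving\<close>, \<open>area_preserving_imp_density\<close>). Both implications are
  about such densities.

  If \<open>w\<close> exists, evaluating at the fixed point \<open>(N, S)\<close> gives \<open>f' N * f' S = 1\<close>. If \<open>f' S = 1\<close>, then
  \<open>w(u, S) du\<close> would be an invariant one-form without zeros on the circle minus \<open>S\<close>. Its primitive is
  injective, and because \<open>N\<close> is fixed the primitive does not change under \<open>f\<close>; so \<open>f\<close> would be
  the identity (\<open>density_not_neutral\<close>).

  Conversely let \<open>f' N = \<lambda> < 1\<close> and \<open>f' S = 1 / \<lambda>\<close>. Every point but \<open>S\<close> is attracted to \<open>N\<close>, and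
  there is a smooth coordinate \<open>\<phi>\<close> on the circle minus \<open>S\<close> in which \<open>f\<close> is multiplication by \<open>\<lambda>\<close>;
  likewise there is \<open>\<psi>\<close> on the circle minus \<open>N\<close> with \<open>\<psi> \<circ> f = \<psi> / \<lambda>\<close> (\<open>linearization\<close>,
  \<open>circle_linearization\<close>). The product \<open>\<phi>'(x) * \<psi>'(y)\<close> is an invariant density where \<open>x \<noteq> S\<close> and
  \<open>y \<noteq> N\<close>; its mirror image is one where \<open>y \<noteq> S\<close> and \<open>x \<noteq> N\<close>. Only the diagonal points \<open>(N, N)\<close> and
  \<open>(S, S)\<close> lie outside both domains. The two densities are glued by an invariant cutoff: the function
  \<open>\<phi> x / \<phi> y\<close> is invariant, tends to \<open>0\<close> at the lines \<open>x = N\<close> and \<open>y = S\<close> and to infinity at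
  \<open>x = S\<close> and \<open>y = N\<close> (\<open>density_exists\<close>).

  The coordinate is found through its derivative \<open>exp h\<close>. Differentiating \<open>\<phi> \<circ> f = \<lambda> * \<phi>\<close> shows that
  \<open>h - h \<circ> f = ln (f' / \<lambda>)\<close>, so \<open>h\<close> is the sum of \<open>ln (f' / \<lambda>)\<close> along the forward orbit, which
  converges because orbits approach \<open>N\<close> geometrically. Smoothness of the sum is obtained by
  bootstrapping: the derivation \<open>exp (-h) * d/dx\<close>, which is \<open>d/d\<phi>\<close>, turns \<open>A \<circ> f\<^sup>i\<close> into
  \<open>\<lambda>\<^sup>i\<close> times another function composed with \<open>f\<^sup>i\<close>, so sums along orbits are as smooth as
  their summands once \<open>h\<close> is, and \<open>h\<close> gains one derivative at each round.

  The statement about the representation reduces to the one about \<open>f\<close>, since nontrivial powers of an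
  orientation-preserving circle homeomorphism with a fixed point have the same fixed points, and
  their multipliers are powers of those of \<open>f\<close>.\<close>

section \<open>Calculus of maps of class \<open>C\<^sup>n\<close>\<close>

text \<open>The class of a map on an open set depends only on its values there, although the iterated
  derivatives are formed with the map on the whole space.\<close>
lemma Cn_cong:
  assumes "open U" "\<And>x. x \<in> U \<Longrightarrow> f x = g x" "times_differentiable_on n f U"
  shows "times_differentiable_on n g U"
  using assms(2,3)
proof (induction n arbitrary: f g)
  case 0
  then show ?case by (auto cong: continuous_on_cong)
next
  case (Suc n)
  have d: "f differentiable (at x)" if "x \<in> U" for x using Suc.prems that by auto
  have hd: "(g has_derivative frechet_derivative f (at x)) (at x)" if "x \<in> U" for x
    using d[OF that, unfolded frechet_derivative_works] \<open>open U\<close> that Suc.prems(1)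
    by (rule has_derivative_transform_within_open)
  have eq: "frechet_derivative f (at x) = frechet_derivative g (at x)" if "x \<in> U" for x
    using hd[OF that] by (rule frechet_derivative_at)
  have "times_differentiable_on n (\<lambda>x. frechet_derivative g (at x) v) U" for v
    by (rule Suc.IH[of "\<lambda>x. frechet_derivative f (at x) v"]) (use Suc.prems eq in auto)
  then show ?case using hd by (auto simp: differentiable_def)
qed

text \<open>With this rule and its converse below, closure properties of \<open>C\<^sup>n\<close> are inductions over \<open>n\<close> in which
  the explicit derivative replaces \<^const>\<open>frechet_derivative\<close>.\<close>
lemma Cn_SucI:
  assumes "open U" "\<And>x. x \<in> U \<Longrightarrow> (f has_derivative f' x) (at x)"
    "\<And>v. times_differentiable_on n (\<lambda>x. f' x v) U"
  shows "times_differentiable_on (Suc n) f U"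
proof -
  have "frechet_derivative f (at x) = f' x" if "x \<in> U" for x
    using assms(2)[OF that] by (metis frechet_derivative_at)
  then have "times_differentiable_on n (\<lambda>x. frechet_derivative f (at x) v) U" for v
    by (intro Cn_cong[OF assms(1) _ assms(3)[of v]]) auto
  then show ?thesis using assms(2) by (auto simp: differentiable_def)
qed

lemma Cn_SucD:
  assumes "times_differentiable_on (Suc n) f U"
  shows "\<And>x. x \<in> U \<Longrightarrow> (f has_derivative frechet_derivative f (at x)) (at x)"
    "\<And>v. times_differentiable_on n (\<lambda>x. frechet_derivative f (at x) v) U"
  using assms by (auto simp: frechet_derivative_works)

lemma Cn_Suc_imp: "times_differentiable_on (Suc n) f U \<Longrightarrow> times_differentiable_on n f U"
proof (induction n arbitrary: f)
  case 0
  then show ?case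
    by (auto intro!: continuous_at_imp_continuous_on differentiable_imp_continuous_within)
next
  case (Suc n)
  then show ?case unfolding times_differentiable_on.simps(2)[of "Suc n"]
    by (auto simp del: times_differentiable_on.simps simp: times_differentiable_on.simps(2)[of n])
qed

lemma Cn_continuous: "times_differentiable_on n f U \<Longrightarrow> continuous_on U f"
  by (induction n) (auto simp del: times_differentiable_on.simps(2) dest: Cn_Suc_imp)

lemma Cn_subset: "times_differentiable_on n f U \<Longrightarrow> V \<subseteq> U \<Longrightarrow> times_differentiable_on n f V"
  by (induction n arbitrary: f) (auto intro: continuous_on_subset)

text \<open>Being of class \<open>C\<^sup>n\<close> is a local property; functions given by different formulas on
  overlapping open pieces are treated by it.\<close>
lemma Cn_local:
  assumes "\<And>x. x \<in> U \<Longrightarrow> \<exists>V. open V \<and> x \<in> V \<and> times_differentiable_on n f V"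
  shows "times_differentiable_on n f U"
  using assms
proof (induction n arbitrary: f)
  case 0
  then have "\<forall>x\<in>U. continuous (at x) f"
    by (metis times_differentiable_on.simps(1) continuous_on_eq_continuous_at)
  then show ?case by (simp add: continuous_at_imp_continuous_on)
next
  case (Suc n)
  have "f differentiable (at x)" if "x \<in> U" for x using Suc.prems[OF that] by auto
  moreover have "times_differentiable_on n (\<lambda>x. frechet_derivative f (at x) v) U" for v
    by (rule Suc.IH) (use Suc.prems in fastforce)
  ultimately show ?case by auto
qed

lemma Cn_const: "times_differentiable_on n (\<lambda>x. c) U"
  by (induction n arbitrary: c) auto

lemma Cn_bounded_linear_id:
  assumes "bounded_linear L" "open U" shows "times_differentiable_on n L U"
proof (cases n)
  case 0
  then show ?thesis using assms by (simp add: linear_continuous_on)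
next
  case (Suc m)
  show ?thesis unfolding Suc
    by (rule Cn_SucI[OF assms(2), where f'="\<lambda>x. L"])
       (auto intro: assms bounded_linear_imp_has_derivative Cn_const)
qed

lemma Cn_linear_comp:
  assumes "bounded_linear L" "open U" "times_differentiable_on n f U"
  shows "times_differentiable_on n (\<lambda>x. L (f x)) U"
  using assms(3)
proof (induction n arbitrary: f)
  case 0
  then show ?case using assms(1) by (auto intro: bounded_linear.continuous_on)
next
  case (Suc n)
  show ?case
    by (rule Cn_SucI[OF assms(2) bounded_linear.has_derivative[OF assms(1) Cn_SucD(1)[OF Suc.prems]]])
       (auto intro: Suc.IH Cn_SucD(2)[OF Suc.prems])
qed

lemma Cn_add:
  assumes "open U" "times_differentiable_on n f U" "times_differentiable_on n g U"
  shows "times_differentiable_on n (\<lambda>x. f x + g x) U"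
  using assms(2,3)
proof (induction n arbitrary: f g)
  case 0
  then show ?case by (auto intro: continuous_on_add)
next
  case (Suc n)
  show ?case
    by (rule Cn_SucI[OF assms(1) has_derivative_add[OF Cn_SucD(1)[OF Suc.prems(1)] Cn_SucD(1)[OF Suc.prems(2)]]])
       (auto intro: Suc.IH Cn_SucD(2)[OF Suc.prems(1)] Cn_SucD(2)[OF Suc.prems(2)])
qed

lemma Cn_mult:
  fixes f g :: "'a::real_normed_vector \<Rightarrow> real"
  assumes "open U" "times_differentiable_on n f U" "times_differentiable_on n g U"
  shows "times_differentiable_on n (\<lambda>x. f x * g x) U"
  using assms(2,3)
proof (induction n arbitrary: f g)
  case 0
  then show ?case by (auto intro: continuous_on_mult)
next
  case (Suc n)
  show ?case
    by (rule Cn_SucI[OF assms(1) has_derivative_mult[OF Cn_SucD(1)[OF Suc.prems(1)] Cn_SucD(1)[OF Suc.prems(2)]]])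
       (auto intro!: Suc.IH Cn_add assms(1) Cn_SucD(2)[OF Suc.prems(1)] Cn_SucD(2)[OF Suc.prems(2)]
          Cn_Suc_imp[OF Suc.prems(1)] Cn_Suc_imp[OF Suc.prems(2)])
qed

lemma Cn_minus:
  fixes f :: "'a::real_normed_vector \<Rightarrow> real"
  shows "open U \<Longrightarrow> times_differentiable_on n f U \<Longrightarrow> times_differentiable_on n (\<lambda>x. - f x) U"
  by (rule Cn_linear_comp[of uminus]) (auto intro: bounded_linear_minus bounded_linear_ident)

lemma Cn_diff:
  fixes f g :: "'a::real_normed_vector \<Rightarrow> real"
  assumes "open U" "times_differentiable_on n f U" "times_differentiable_on n g U"
  shows "times_differentiable_on n (\<lambda>x. f x - g x) U"
  using Cn_add[OF assms(1,2) Cn_minus[OF assms(1,3)]] by simp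

text \<open>Only real-valued inner functions are composed, so the chain rule gives a product of two real
  functions and the induction needs nothing beyond closure under multiplication.\<close>
lemma Cn_compose:
  fixes g :: "'a::real_normed_vector \<Rightarrow> real" and F :: "real \<Rightarrow> real"
  assumes "open U" "times_differentiable_on n g U" "times_differentiable_on n F V" "g ` U \<subseteq> V"
  shows "times_differentiable_on n (\<lambda>x. F (g x)) U"
  using assms(2,3)
proof (induction n arbitrary: F)
  case 0
  then show ?case using assms(4) by (auto intro: continuous_on_compose2)
next
  case (Suc n)
  have lin: "frechet_derivative F (at y) v = v * frechet_derivative F (at y) 1" if "y \<in> V" for y v
  proof -
    have "linear (frechet_derivative F (at y))"
      using Cn_SucD(1)[OF Suc.prems(2) that] has_derivative_linear by blast
    from linear_scale[OF this, of v 1] show ?thesis by simp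
  qed
  show ?case
  proof (rule Cn_SucI[OF assms(1)])
    fix x assume x: "x \<in> U"
    then have gx: "g x \<in> V" using assms(4) by auto
    show "((\<lambda>x. F (g x)) has_derivative
        (\<lambda>v. frechet_derivative g (at x) v * frechet_derivative F (at (g x)) 1)) (at x)"
    proof -
      have "(\<lambda>v. frechet_derivative F (at (g x)) (frechet_derivative g (at x) v)) =
          (\<lambda>v. frechet_derivative g (at x) v * frechet_derivative F (at (g x)) 1)"
        by (rule ext) (rule lin[OF gx])
      with has_derivative_compose[OF Cn_SucD(1)[OF Suc.prems(1) x] Cn_SucD(1)[OF Suc.prems(2) gx]]
      show ?thesis by metis
    qed
  next
    fix v
    show "times_differentiable_on n
        (\<lambda>x. frechet_derivative g (at x) v * frechet_derivative F (at (g x)) 1) U"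
      by (rule Cn_mult[OF assms(1) Cn_SucD(2)[OF Suc.prems(1)]
           Suc.IH[OF Cn_Suc_imp[OF Suc.prems(1)] Cn_SucD(2)[OF Suc.prems(2)]]])
  qed
qed

lemma Cn_linear_precompose:
  assumes "bounded_linear L" "open U" "open V" "L ` V \<subseteq> U" "times_differentiable_on n f U"
  shows "times_differentiable_on n (\<lambda>x. f (L x)) V"
  using assms(5)
proof (induction n arbitrary: f)
  case 0
  then show ?case
    using assms(1,4) by (auto intro: continuous_on_compose2 linear_continuous_on)
next
  case (Suc n)
  show ?case
  proof (rule Cn_SucI[OF assms(3)])
    fix x assume "x \<in> V"
    then have "L x \<in> U" using assms(4) by auto
    then show "((\<lambda>x. f (L x)) has_derivative (\<lambda>v. frechet_derivative f (at (L x)) (L v))) (at x)"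
      by (rule has_derivative_compose[OF bounded_linear_imp_has_derivative[OF assms(1)] Cn_SucD(1)[OF Suc.prems]])
  qed (rule Suc.IH[OF Cn_SucD(2)[OF Suc.prems]])
qed

lemma Cn_real_SucI:
  fixes f :: "real \<Rightarrow> real"
  assumes "open U" "\<And>x. x \<in> U \<Longrightarrow> (f has_real_derivative f' x) (at x)"
    "times_differentiable_on n f' U"
  shows "times_differentiable_on (Suc n) f U"
  by (rule Cn_SucI[OF assms(1) assms(2)[unfolded has_field_derivative_def]])
     (auto intro: Cn_mult Cn_const assms)

lemma Cn_real_SucD:
  fixes f :: "real \<Rightarrow> real"
  assumes "times_differentiable_on (Suc n) f U" "open U"
  shows "\<And>x. x \<in> U \<Longrightarrow> (f has_real_derivative deriv f x) (at x)"
    "times_differentiable_on n (deriv f) U"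
proof -
  show 1: "(f has_real_derivative deriv f x) (at x)" if "x \<in> U" for x
    using assms that DERIV_deriv_iff_real_differentiable by auto
  have "frechet_derivative f (at x) 1 = deriv f x" if "x \<in> U" for x
    using 1[OF that] frechet_derivative_at[of f "(*) (deriv f x)" x]
    by (metis has_field_derivative_def mult.right_neutral)
  then show "times_differentiable_on n (deriv f) U"
    by (intro Cn_cong[OF assms(2) _ Cn_SucD(2)[OF assms(1), of 1]]) auto
qed

lemma Cn_exp: "open U \<Longrightarrow> times_differentiable_on n (exp :: real \<Rightarrow> real) U"
proof (induction n)
  case 0
  show ?case by (auto intro: continuous_intros)
next
  case (Suc n)
  then show ?case by (intro Cn_real_SucI[OF _ DERIV_exp]) auto
qed

lemma Cn_inverse: "times_differentiable_on n (inverse :: real \<Rightarrow> real) (- {0})"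
proof (induction n)
  case 0
  show ?case by (auto intro!: continuous_intros)
next
  case (Suc n)
  have "times_differentiable_on n (\<lambda>x::real. - (inverse x * inverse x)) (- {0})"
    by (intro Cn_minus Cn_mult Suc) auto
  then show ?case
    by (rule Cn_real_SucI[rotated 2]) (auto intro!: derivative_eq_intros)
qed

lemma Cn_ln: "times_differentiable_on n (ln :: real \<Rightarrow> real) {0<..}"
proof (cases n)
  case 0
  then show ?thesis by (auto intro!: continuous_intros)
next
  case (Suc m)
  have "times_differentiable_on m (inverse :: real \<Rightarrow> real) {0<..}"
    by (rule Cn_subset[OF Cn_inverse]) auto
  then show ?thesis unfolding Suc
    by (rule Cn_real_SucI[rotated 2]) (auto intro!: derivative_eq_intros simp: divide_inverse)
qed

section \<open>A smooth cutoff\<close>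

text \<open>The functions \<open>exp (-1/x) / x\<^sup>k\<close>, extended by \<open>0\<close>. All exponents are considered together
  because the derivative of one of them is a combination of two others.\<close>
definition flat_exp :: "nat \<Rightarrow> real \<Rightarrow> real" where
  "flat_exp k x = (if x \<le> 0 then 0 else exp (- inverse x) * inverse x ^ k)"

lemma flat_exp_tendsto_0: "(flat_exp k \<longlongrightarrow> 0) (at 0)"
proof -
  have "((\<lambda>y::real. y ^ k / exp y) \<longlongrightarrow> 0) at_top" by (rule tendsto_power_div_exp_0)
  from filterlim_compose[OF this filterlim_inverse_at_top_right]
  have "((\<lambda>x::real. exp (- inverse x) * inverse x ^ k) \<longlongrightarrow> 0) (at_right 0)"
    by (simp add: exp_minus divide_inverse mult.commute)
  then have "(flat_exp k \<longlongrightarrow> 0) (at_right 0)"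
    by (rule Lim_transform_eventually)
       (auto simp: flat_exp_def eventually_at_filter)
  moreover have "(flat_exp k \<longlongrightarrow> 0) (at_left 0)"
    by (rule Lim_transform_eventually[OF tendsto_const[of 0]])
       (auto simp: flat_exp_def eventually_at_filter)
  ultimately show ?thesis by (simp add: filterlim_split_at)
qed

lemma flat_exp_deriv:
  "(flat_exp k has_real_derivative flat_exp (k+2) x - k * flat_exp (k+1) x) (at x)"
proof -
  consider "x < 0" | "x > 0" | "x = 0" by linarith
  then show ?thesis
  proof cases
    case 1
    have "((\<lambda>_. 0) has_real_derivative 0) (at x)" by simp
    then have "(flat_exp k has_real_derivative 0) (at x)"
      by (rule has_field_derivative_transform_within_open[where S="{..<0}"])
         (use 1 in \<open>auto simp: flat_exp_def\<close>)
    then show ?thesis using 1 by (simp add: flat_exp_def)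
  next
    case 2
    have "((\<lambda>x. exp (- inverse x) * inverse x ^ k) has_real_derivative
           exp (- inverse x) * inverse x ^ (k+2) - k * (exp (- inverse x) * inverse x ^ (k+1))) (at x)"
    proof -
      have "inverse x * inverse x ^ (j - Suc 0) = inverse x ^ j" if "j \<noteq> 0" for j
        using that by (cases j) auto
      then show ?thesis
        using 2 by (cases k; auto intro!: derivative_eq_intros simp: algebra_simps) (metis neq0_conv)
    qed
    then have "(flat_exp k has_real_derivative
           exp (- inverse x) * inverse x ^ (k+2) - k * (exp (- inverse x) * inverse x ^ (k+1))) (at x)"
      by (rule has_field_derivative_transform_within_open[where S="{0<..}"])
         (use 2 in \<open>auto simp: flat_exp_def\<close>)
    then show ?thesis using 2 by (simp add: flat_exp_def)
  next
    case 3
    have "(\<lambda>y. (flat_exp k y - flat_exp k 0) / (y - 0)) = flat_exp (Suc k)"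
      by (auto simp: flat_exp_def fun_eq_iff divide_inverse)
    with flat_exp_tendsto_0[of "Suc k"] have "(flat_exp k has_real_derivative 0) (at 0)"
      by (simp add: has_field_derivative_iff)
    then show ?thesis using 3 by (simp add: flat_exp_def)
  qed
qed

lemma Cn_flat_exp: "times_differentiable_on n (flat_exp k) UNIV"
proof (induction n arbitrary: k)
  case 0
  show ?case by (simp add: DERIV_isCont[OF flat_exp_deriv] continuous_at_imp_continuous_on)
next
  case (Suc n)
  show ?case by (rule Cn_real_SucI[OF _ flat_exp_deriv]) (intro Cn_diff Cn_mult Cn_const Suc open_UNIV)+
qed

text \<open>The inner difference is constant for \<open>r \<le> 1\<close> and reaches \<open>0\<close> at \<open>r = 2\<close>; applying the flat
  function once more makes the decay to \<open>0\<close> smooth. No division is involved, so the constant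
  value is not normalized to \<open>1\<close>.\<close>
definition cutoff :: "real \<Rightarrow> real" where
  "cutoff r = flat_exp 0 (flat_exp 0 1 - flat_exp 0 (r - 1))"

lemma cutoff_const: "r \<le> 1 \<Longrightarrow> cutoff r = cutoff 0"
  and cutoff_zero: "2 \<le> r \<Longrightarrow> cutoff r = 0"
  and cutoff_pos: "r < 2 \<Longrightarrow> 0 < cutoff r"
  and cutoff_nonneg: "0 \<le> cutoff r"
  by (auto simp: cutoff_def flat_exp_def not_le le_less le_diff_eq inverse_eq_divide divide_simps)

lemma Cn_cutoff: "times_differentiable_on n cutoff UNIV"
proof -
  have a: "times_differentiable_on n (\<lambda>r::real. r - 1) UNIV"
    by (intro Cn_diff Cn_const Cn_bounded_linear_id bounded_linear_ident open_UNIV)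
  have "times_differentiable_on n (\<lambda>r. flat_exp 0 (flat_exp 0 1 - flat_exp 0 (r - 1))) UNIV"
    by (intro Cn_compose[OF _ _ Cn_flat_exp] Cn_diff Cn_const a open_UNIV) auto
  then show ?thesis by (simp add: cutoff_def[abs_def])
qed

section \<open>Smooth linearization of a contraction\<close>

text \<open>A diffeomorphism of an open interval with one hyperbolic attracting fixed point. These
  hypotheses force every orbit to converge monotonically to \<open>c\<close>.\<close>
locale interval_contraction =
  fixes F :: "real \<Rightarrow> real" and a b c :: real
  assumes c_in: "a < c" "c < b"
    and onto: "F ` {a<..<b} = {a<..<b}"
    and fixed: "F c = c"
    and smooth: "\<And>n. times_differentiable_on n F {a<..<b}"
    and deriv_pos: "\<And>x. x \<in> {a<..<b} \<Longrightarrow> 0 < deriv F x"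
    and only_fixed: "\<And>x. x \<in> {a<..<b} \<Longrightarrow> F x = x \<Longrightarrow> x = c"
    and deriv_less_1: "deriv F c < 1"
begin

abbreviation (input) "I \<equiv> {a<..<b}"

definition "lam = deriv F c"

lemma c_I: "c \<in> I" using c_in by auto

lemma lam: "0 < lam" "lam < 1"
  using deriv_pos[OF c_I] deriv_less_1 by (auto simp: lam_def)

lemma F_I: "x \<in> I \<Longrightarrow> F x \<in> I" using onto by blast

lemma F_deriv: "x \<in> I \<Longrightarrow> (F has_real_derivative deriv F x) (at x)"
  by (rule Cn_real_SucD(1)[OF smooth[of 1, unfolded One_nat_def]]) auto

lemma F_mono: "x \<in> I \<Longrightarrow> y \<in> I \<Longrightarrow> x < y \<Longrightarrow> F x < F y"
  by (rule DERIV_pos_imp_increasing)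
     (auto intro!: exI[of _ "deriv F _"] F_deriv deriv_pos)

lemma F_cont: "continuous_on I F"
  using smooth[of 0] by simp

text \<open>Since \<open>F' c < 1\<close>, points just to the right of \<open>c\<close> move left. A point that does not would
  enclose with them a second fixed point.\<close>
lemma F_right: assumes "c < x" "x < b" shows "c < F x" "F x < x"
proof -
  show "c < F x" using F_mono[of c x] assms c_in fixed by auto
  have "((\<lambda>x. F x - x) has_real_derivative lam - 1) (at c)"
    using F_deriv[OF c_I] by (auto intro!: derivative_eq_intros simp: lam_def)
  from DERIV_neg_dec_right[OF this] lam obtain d where d: "d > 0"
    "\<And>h. 0 < h \<Longrightarrow> h < d \<Longrightarrow> F (c + h) - (c + h) < F c - c" by auto
  define y where "y = c + min (d/2) (x - c)"
  have y: "c < y" "y \<le> x" "F y < y"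
    using d(1) d(2)[of "min (d/2) (x - c)"] assms fixed by (auto simp: y_def min_def)
  show "F x < x"
  proof (rule ccontr)
    assume "\<not> F x < x"
    then have "0 \<le> F x - x" by simp
    moreover have "continuous_on {y..x} (\<lambda>x. F x - x)"
      by (intro continuous_intros continuous_on_subset[OF F_cont]) (use y assms c_in in auto)
    ultimately obtain z where "y \<le> z" "z \<le> x" "F z - z = 0"
      using IVT'[of "\<lambda>x. F x - x" y 0 x] y by auto
    then show False using only_fixed[of z] y assms c_in by auto
  qed
qed

lemma F_left: assumes "a < x" "x < c" shows "x < F x" "F x < c"
proof -
  show "F x < c" using F_mono[of x c] assms c_in fixed by auto
  have "((\<lambda>x. F x - x) has_real_derivative lam - 1) (at c)"
    using F_deriv[OF c_I] by (auto intro!: derivative_eq_intros simp: lam_def)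
  from DERIV_neg_dec_left[OF this] lam obtain d where d: "d > 0"
    "\<And>h. 0 < h \<Longrightarrow> h < d \<Longrightarrow> F c - c < F (c - h) - (c - h)" by auto
  define y where "y = c - min (d/2) (c - x)"
  have y: "y < c" "x \<le> y" "y < F y"
    using d(1) d(2)[of "min (d/2) (c - x)"] assms fixed by (auto simp: y_def min_def)
  show "x < F x"
  proof (rule ccontr)
    assume "\<not> x < F x"
    then have "F x - x \<le> 0" by simp
    moreover have "continuous_on {x..y} (\<lambda>x. F x - x)"
      by (intro continuous_intros continuous_on_subset[OF F_cont]) (use y assms c_in in auto)
    ultimately obtain z where "x \<le> z" "z \<le> y" "F z - z = 0"
      using IVT'[of "\<lambda>x. F x - x" x 0 y] y by auto
    then show False using only_fixed[of z] y assms c_in by auto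
  qed
qed

lemma iter_segment:
  assumes "a < p" "p < c" "c < q" "q < b" "x \<in> {p..q}"
  shows "(F ^^ i) x \<in> {p..q}"
proof (induction i)
  case (Suc i)
  define y where "y = (F ^^ i) x"
  have "F y \<in> {p..q}"
    using Suc F_left[of y] F_right[of y] fixed assms
    by (cases "y < c"; cases "y = c") (auto simp: y_def[symmetric])
  then show ?case by (simp add: y_def)
qed (use assms in auto)

lemma iter_I: "x \<in> I \<Longrightarrow> (F ^^ i) x \<in> I"
  by (induction i) (use F_I in auto)

lemma segment:
  assumes "x \<in> I" obtains p q where "a < p" "p < c" "c < q" "q < b" "p < x" "x < q"
proof
  show "a < (a + min x c) / 2" "(a + min x c) / 2 < c" "(a + min x c) / 2 < x"
    "c < (b + max x c) / 2" "(b + max x c) / 2 < b" "x < (b + max x c) / 2"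
    using assms c_in by (auto simp: min_def max_def)
qed

text \<open>The quotient \<open>(F x - c) / (x - c)\<close>, extended by \<open>lam\<close> at \<open>c\<close>, is continuous with values in
  \<open>[0, 1)\<close>. Its maximum over a compact segment is therefore a contraction rate on the whole
  segment, not only near \<open>c\<close>.\<close>
lemma uniform_rate:
  assumes "a < p" "p < c" "c < q" "q < b"
  obtains \<mu> where "0 \<le> \<mu>" "\<mu> < 1" "\<And>i x. x \<in> {p..q} \<Longrightarrow> \<bar>(F ^^ i) x - c\<bar> \<le> \<mu> ^ i * (q - p)"
proof -
  define Q where "Q x = (if x = c then lam else (F x - c) / (x - c))" for x
  have "isCont Q x" if x: "x \<in> {p..q}" for x
  proof (cases "x = c")
    case True
    have "((\<lambda>y. (F y - F c) / (y - c)) \<longlongrightarrow> lam) (at c)"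
      using F_deriv[OF c_I] by (simp add: has_field_derivative_iff lam_def)
    then have "(Q \<longlongrightarrow> lam) (at c)"
      by (rule Lim_transform_eventually)
         (auto simp: Q_def fixed eventually_at intro!: exI[of _ 1])
    then show ?thesis using True by (simp add: isCont_def Q_def)
  next
    case False
    have "isCont F x" using x assms by (intro DERIV_isCont[OF F_deriv]) auto
    then have "isCont (\<lambda>x. (F x - c) / (x - c)) x" using False by (intro continuous_intros) auto
    then show ?thesis
      by (rule isCont_cong[THEN iffD1, rotated])
         (use False in \<open>auto simp: Q_def eventually_nhds intro!: exI[of _ "- {c}"]\<close>)
  qed
  then have "continuous_on {p..q} Q" by (simp add: continuous_at_imp_continuous_on)
  then obtain m where m: "m \<in> {p..q}" "\<And>x. x \<in> {p..q} \<Longrightarrow> Q x \<le> Q m"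
    using continuous_attains_sup[of "{p..q}" Q] assms by (auto simp: less_imp_le)
  have Q: "0 \<le> Q x" "Q x < 1" "\<bar>F x - c\<bar> = Q x * \<bar>x - c\<bar>" if "x \<in> {p..q}" for x
  proof -
    consider "x < c" | "x = c" | "c < x" by linarith
    then have "0 \<le> Q x \<and> Q x < 1 \<and> \<bar>F x - c\<bar> = Q x * \<bar>x - c\<bar>"
    proof cases
      case 1
      then have "x < F x" "F x < c" using F_left[of x] that assms by auto
      then show ?thesis using 1 by (auto simp: Q_def divide_simps algebra_simps)
    next
      case 2
      then show ?thesis using lam fixed by (auto simp: Q_def)
    next
      case 3
      then have "c < F x" "F x < x" using F_right[of x] that assms by auto
      then show ?thesis using 3 by (auto simp: Q_def divide_simps)
    qed
    then show "0 \<le> Q x" "Q x < 1" "\<bar>F x - c\<bar> = Q x * \<bar>x - c\<bar>" by auto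
  qed
  have "\<bar>(F ^^ i) x - c\<bar> \<le> Q m ^ i * (q - p)" if "x \<in> {p..q}" for i x
  proof (induction i)
    case 0
    show ?case using that assms by auto
  next
    case (Suc i)
    define y where "y = (F ^^ i) x"
    have y: "y \<in> {p..q}" using iter_segment[OF assms that] by (simp add: y_def)
    have "\<bar>F y - c\<bar> \<le> Q m * \<bar>y - c\<bar>"
      using Q(3)[OF y] m(2)[OF y] by (simp add: mult_right_mono)
    also have "\<dots> \<le> Q m * (Q m ^ i * (q - p))"
      using Suc Q(1)[OF m(1)] by (intro mult_left_mono) (auto simp: y_def)
    finally show ?case by (simp add: y_def mult.assoc)
  qed
  then show ?thesis using that[of "Q m"] Q(1,2)[OF m(1)] by auto
qed

text \<open>The deviation of \<open>F\<close> from its linear part at \<open>c\<close>, on a logarithmic scale.\<close>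
definition "distortion x = ln (deriv F x * inverse lam)"

lemma Cn_deriv_F: "times_differentiable_on n (deriv F) I"
  by (rule Cn_real_SucD(2)[OF smooth]) auto

lemma Cn_distortion: "times_differentiable_on n distortion I"
  unfolding distortion_def[abs_def]
  by (rule Cn_compose[OF _ _ Cn_ln])
     (use deriv_pos lam in \<open>auto intro!: Cn_mult Cn_const Cn_deriv_F\<close>)

lemma deriv_F_distortion: "x \<in> I \<Longrightarrow> deriv F x = lam * exp (distortion x)"
  using deriv_pos[of x] lam by (simp add: distortion_def)

lemma distortion_c: "distortion c = 0"
  using lam by (simp add: distortion_def lam_def[symmetric])

text \<open>The distortion vanishes at \<open>c\<close> and is Lipschitz on the segment, so along an orbit it decays as
  fast as the distance to \<open>c\<close>.\<close>
lemma distortion_series: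
  assumes "a < p" "p < c" "c < q" "q < b"
  obtains M where "summable M" "\<And>i x. x \<in> {p..q} \<Longrightarrow> norm (distortion ((F ^^ i) x)) \<le> M i"
proof -
  obtain \<mu> where \<mu>: "0 \<le> \<mu>" "\<mu> < 1"
    "\<And>i x. x \<in> {p..q} \<Longrightarrow> \<bar>(F ^^ i) x - c\<bar> \<le> \<mu> ^ i * (q - p)"
    using uniform_rate[OF assms] by blast
  have sub: "{p..q} \<subseteq> I" using assms by auto
  have "continuous_on {p..q} (deriv distortion)"
    using Cn_real_SucD(2)[OF Cn_distortion[of "Suc 0"]] sub by (auto intro: continuous_on_subset)
  then have "compact (deriv distortion ` {p..q})" by (intro compact_continuous_image) auto
  then obtain B where B: "\<And>x. x \<in> {p..q} \<Longrightarrow> norm (deriv distortion x) \<le> B"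
    using compact_imp_bounded bounded_iff by (metis imageI)
  have distortion: "norm (distortion x) \<le> B * \<bar>x - c\<bar>" if "x \<in> {p..q}" for x
  proof -
    have "norm (distortion x - distortion c) \<le> B * norm (x - c)"
      by (rule field_differentiable_bound[where S="{p..q}" and f'="deriv distortion"])
         (use that assms B sub Cn_real_SucD(1)[OF Cn_distortion[of "Suc 0"]]
          in \<open>auto intro: has_field_derivative_at_within\<close>)
    then show ?thesis by (simp add: distortion_c)
  qed
  have "0 \<le> B" using B[of c] assms by force
  show ?thesis
  proof
    show "summable (\<lambda>i. B * (\<mu> ^ i * (q - p)))"
      using \<mu> by (intro summable_mult summable_mult2 summable_geometric) auto
    fix i x assume x: "x \<in> {p..q}"
    show "norm (distortion ((F ^^ i) x)) \<le> B * (\<mu> ^ i * (q - p))"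
      using distortion[OF iter_segment[OF assms x, of i]] mult_left_mono[OF \<mu>(3)[OF x, of i] \<open>0 \<le> B\<close>]
      by linarith
  qed
qed

text \<open>The logarithm of the derivative of the linearizing coordinate.\<close>
definition "log_density x = (\<Sum>i. distortion ((F ^^ i) x))"

lemma summable_distortion: "x \<in> I \<Longrightarrow> summable (\<lambda>i. distortion ((F ^^ i) x))"
  by (erule segment, rule distortion_series, assumption+) (auto intro: summable_comparison_test')

lemma log_density_eq: "x \<in> I \<Longrightarrow> log_density x = distortion x + log_density (F x)"
  using suminf_split_head[OF summable_distortion[of x]]
  by (simp add: log_density_def funpow_swap1)

lemma iter_cont: "continuous_on I (\<lambda>x. (F ^^ i) x)"
proof (induction i)
  case (Suc i)
  then show ?case
    using continuous_on_compose2[OF F_cont Suc] iter_I by (auto simp: image_subset_iff)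
qed (auto intro: continuous_intros)

lemma continuous_on_segments:
  assumes "\<And>p q. a < p \<Longrightarrow> p < c \<Longrightarrow> c < q \<Longrightarrow> q < b \<Longrightarrow> continuous_on {p..q} H"
  shows "continuous_on I (H :: real \<Rightarrow> real)"
proof (rule continuous_at_imp_continuous_on, rule ballI)
  fix x assume "x \<in> I"
  then obtain p q where pq: "a < p" "p < c" "c < q" "q < b" "p < x" "x < q" by (rule segment)
  show "isCont H x"
    by (rule continuous_on_interior[OF assms[OF pq(1-4)]]) (use pq in auto)
qed

lemma series_continuous:
  fixes A :: "real \<Rightarrow> real" and k :: "nat \<Rightarrow> real"
  assumes A: "continuous_on I A" and M: "summable M"
    "\<And>i x. x \<in> {p..q} \<Longrightarrow> norm (k i * A ((F ^^ i) x)) \<le> M i"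
    and "a < p" "p < c" "c < q" "q < b"
  shows "continuous_on {p..q} (\<lambda>x. \<Sum>i. k i * A ((F ^^ i) x))"
proof (rule uniform_limit_theorem[OF _ Weierstrass_m_test[OF M(2,1)]])
  have "continuous_on I (\<lambda>x. \<Sum>i<n. k i * A ((F ^^ i) x))" for n
    by (intro continuous_intros continuous_on_compose2[OF A iter_cont]) (use iter_I in auto)
  then show "\<forall>\<^sub>F n in sequentially. continuous_on {p..q} (\<lambda>x. \<Sum>i<n. k i * A ((F ^^ i) x))"
    by (intro always_eventually allI) (rule continuous_on_subset, use assms(4-) in auto)
qed auto

lemma log_density_cont: "continuous_on I log_density"
proof (rule continuous_on_segments)
  fix p q assume pq: "a < p" "p < c" "c < q" "q < b"
  obtain M where "summable M" "\<And>i x. x \<in> {p..q} \<Longrightarrow> norm (distortion ((F ^^ i) x)) \<le> M i"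
    using distortion_series[OF pq] by blast
  then show "continuous_on {p..q} log_density"
    using series_continuous[of distortion M p q "\<lambda>_. 1"] Cn_distortion[of 0] pq by (simp add: log_density_def[abs_def])
qed

text \<open>By \<open>log_density_eq\<close> the product of the derivatives of \<open>F\<close> along the orbit telescopes.\<close>
lemma iter_deriv:
  "x \<in> I \<Longrightarrow> ((F ^^ i) has_real_derivative lam ^ i * exp (log_density x - log_density ((F ^^ i) x))) (at x)"
proof (induction i)
  case (Suc i)
  have I: "(F ^^ i) x \<in> I" using Suc.prems iter_I by blast
  from DERIV_chain[OF F_deriv[OF I] Suc.IH[OF Suc.prems]]
  show ?case
    by (simp add: deriv_F_distortion[OF I] log_density_eq[OF I] o_def exp_diff exp_add divide_simps mult.assoc)
qed (simp add: id_def)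

lemma bounded_on_segment:
  assumes "continuous_on I E" "a < p" "p < c" "c < q" "q < b"
  obtains B where "0 \<le> B" "\<And>i x. x \<in> {p..q} \<Longrightarrow> \<bar>E ((F ^^ i) x)\<bar> \<le> (B :: real)"
proof -
  have "compact (E ` {p..q})"
    by (intro compact_continuous_image continuous_on_subset[OF assms(1)]) (use assms in auto)
  then obtain B where B: "\<And>x. x \<in> {p..q} \<Longrightarrow> norm (E x) \<le> B"
    using compact_imp_bounded bounded_iff by (metis imageI)
  show ?thesis
  proof (rule that)
    show "0 \<le> B" using B[of c] assms by force
    show "\<bar>E ((F ^^ i) x)\<bar> \<le> B" if "x \<in> {p..q}" for i x
      using B[OF iter_segment[OF assms(2-) that]] by simp
  qed
qed

text \<open>Where the series converges it solves the twisted cohomological equation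
  \<open>B - k * (B \<circ> F) = A\<close> for \<open>B\<close>.\<close>
definition orbit_sum :: "real \<Rightarrow> (real \<Rightarrow> real) \<Rightarrow> real \<Rightarrow> real" where
  "orbit_sum k A x = (\<Sum>i. k ^ i * A ((F ^^ i) x))"

text \<open>Let \<open>h\<close> be the logarithmic density. By \<open>iter_deriv\<close> the derivation \<open>exp (- h) * d/dx\<close> turns an
  orbit sum with weight \<open>k\<close> termwise into one with weight \<open>k * lam\<close>. The additional factor \<open>lam\<close>
  makes the differentiated series converge even when \<open>k = 1\<close>.\<close>
lemma orbit_sum_deriv:
  assumes A: "\<And>x. x \<in> I \<Longrightarrow> (A has_real_derivative A' x) (at x)" "continuous_on I A'"
    and k: "0 < k" "k \<le> 1" "summable (\<lambda>i. k ^ i * A c)" and x: "x \<in> I"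
  shows "(orbit_sum k A has_real_derivative exp (log_density x) *
          orbit_sum (k * lam) (\<lambda>x. exp (- log_density x) * A' x) x) (at x)"
proof -
  obtain p q where pq: "a < p" "p < c" "c < q" "q < b" "p < x" "x < q" using x by (rule segment)
  have sub: "{p..q} \<subseteq> I" using pq by auto
  define E where "E x = exp (- log_density x) * A' x" for x
  have E: "continuous_on I E" unfolding E_def using A log_density_cont by (intro continuous_intros)
  obtain B where B: "0 \<le> B" "\<And>i x. x \<in> {p..q} \<Longrightarrow> \<bar>E ((F ^^ i) x)\<bar> \<le> B"
    using bounded_on_segment[OF E pq(1-4)] by blast
  obtain C where C: "0 \<le> C" "\<And>i x. x \<in> {p..q} \<Longrightarrow> \<bar>exp (log_density ((F ^^ i) x))\<bar> \<le> C"
    using bounded_on_segment[of "\<lambda>x. exp (log_density x)", OF _ pq(1-4)] log_density_cont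
    by (metis continuous_on_exp)
  define f' where "f' i x = exp (log_density x) * ((k * lam) ^ i * E ((F ^^ i) x))" for i x
  have bound: "norm (f' i x) \<le> C * (lam ^ i * B)" if "x \<in> {p..q}" for i x
  proof -
    have "\<bar>exp (log_density x)\<bar> \<le> C" using C(2)[OF that, of 0] by simp
    moreover have "(k * lam) ^ i \<le> lam ^ i" using k lam by (intro power_mono) auto
    ultimately show ?thesis unfolding f'_def using B(1) B(2)[OF that, of i] C(1) k lam
      by (auto simp: abs_mult intro!: mult_mono)
  qed
  have der: "((\<lambda>x. k ^ i * A ((F ^^ i) x)) has_real_derivative f' i x) (at x)" if "x \<in> I" for i x
    using DERIV_cmult[OF DERIV_chain2[OF A(1)[OF iter_I[OF that]] iter_deriv[OF that]], of "k ^ i" i]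
    by (simp add: f'_def E_def exp_diff exp_minus divide_inverse power_mult_distrib mult_ac)
  have "((\<lambda>x. \<Sum>i. k ^ i * A ((F ^^ i) x)) has_real_derivative (\<Sum>i. f' i x)) (at x)"
  proof (rule has_field_derivative_series'(2)[where S="{p..q}" and f'=f' and ?x0.0=c])
    show "uniformly_convergent_on {p..q} (\<lambda>n x. \<Sum>i<n. f' i x)"
      by (rule Weierstrass_m_test'[OF bound])
         (use lam in \<open>auto intro!: summable_mult summable_mult2 summable_geometric\<close>)
    have "(F ^^ i) c = c" for i by (induction i) (auto simp: fixed)
    then show "summable (\<lambda>i. k ^ i * A ((F ^^ i) c))" using k by simp
  qed (use pq sub der in \<open>auto intro: has_field_derivative_at_within\<close>)
  moreover have "(\<Sum>i. f' i x) = exp (log_density x) *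
          orbit_sum (k * lam) E x"
    unfolding orbit_sum_def f'_def
  proof (rule suminf_mult)
    show "summable (\<lambda>i. (k * lam) ^ i * E ((F ^^ i) x))"
    proof (rule summable_comparison_test'[where g="\<lambda>i. lam ^ i * B" and N=0])
      show "summable (\<lambda>i. lam ^ i * B)" using lam by (intro summable_mult2 summable_geometric) auto
      fix i
      have "(k * lam) ^ i \<le> lam ^ i" using k lam by (intro power_mono) auto
      then show "norm ((k * lam) ^ i * E ((F ^^ i) x)) \<le> lam ^ i * B"
        using B(2)[of x i] pq k lam by (auto simp: abs_mult intro!: mult_mono)
    qed
  qed
  ultimately show ?thesis by (simp add: orbit_sum_def[abs_def] E_def[abs_def])
qed

text \<open>Bootstrapping: if \<open>A\<close> is of class \<open>C\<^sup>n\<^sup>+\<^sup>1\<close>, the derivative of its orbit sum is, up to factors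
  made from the logarithmic density, an orbit sum of a function of class \<open>C\<^sup>n\<close>.\<close>
lemma Cn_orbit_sum:
  "times_differentiable_on n log_density I \<Longrightarrow> 0 < k \<Longrightarrow> k < 1 \<Longrightarrow> times_differentiable_on n A I
    \<Longrightarrow> times_differentiable_on n (orbit_sum k A) I"
proof (induction n arbitrary: k A)
  case 0
  have "continuous_on I (\<lambda>x. orbit_sum k A x)"
  proof (rule continuous_on_segments)
    fix p q assume pq: "a < p" "p < c" "c < q" "q < b"
    obtain B where B: "0 \<le> B" "\<And>i x. x \<in> {p..q} \<Longrightarrow> \<bar>A ((F ^^ i) x)\<bar> \<le> B"
      using bounded_on_segment[OF _ pq] 0 by (metis times_differentiable_on.simps(1))
    show "continuous_on {p..q} (orbit_sum k A)"
      unfolding orbit_sum_def[abs_def]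
      by (rule series_continuous[where M="\<lambda>i. k ^ i * B"])
         (use 0 B pq in \<open>auto intro!: summable_mult2 summable_geometric mult_left_mono simp: abs_mult\<close>)
  qed
  then show ?case by simp
next
  case (Suc n)
  have log_density: "times_differentiable_on n log_density I" by (rule Cn_Suc_imp) fact
  note A = Cn_real_SucD[OF Suc.prems(4)]
  have A': "continuous_on I (deriv A)"
    using Cn_continuous[OF A(2)] by simp
  have E: "times_differentiable_on n (\<lambda>x. exp (- log_density x) * deriv A x) I"
    by (intro Cn_mult Cn_compose[OF _ _ Cn_exp[OF open_UNIV]] Cn_minus log_density A(2)) auto
  show ?case
  proof (rule Cn_real_SucI)
    show "times_differentiable_on n (\<lambda>x. exp (log_density x) *
          orbit_sum (k * lam) (\<lambda>x. exp (- log_density x) * deriv A x) x) I"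
      by (intro Cn_mult Cn_compose[OF _ _ Cn_exp[OF open_UNIV]] log_density Suc.IH[OF log_density _ _ E])
         (use Suc.prems lam in \<open>auto intro: mult_strict_mono'[of k 1 lam 1, simplified]\<close>)
    show "(orbit_sum k A has_real_derivative exp (log_density x) *
          orbit_sum (k * lam) (\<lambda>x. exp (- log_density x) * deriv A x) x) (at x)"
      if "x \<in> I" for x
      by (rule orbit_sum_deriv[OF A(1) A']) (use Suc.prems that in \<open>auto intro!: summable_mult2 summable_geometric\<close>)
  qed auto
qed

text \<open>The logarithmic density is itself an orbit sum, of weight \<open>1\<close>. Its derivative is an orbit sum of
  weight \<open>lam < 1\<close>, to which the previous lemma applies with only the smoothness
  established so far.\<close>
lemma Cn_log_density: "times_differentiable_on n log_density I"
proof (induction n)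
  case 0
  show ?case using log_density_cont by simp
next
  case (Suc n)
  note distortion = Cn_real_SucD[OF Cn_distortion[of "Suc _"]]
  show ?case
  proof (rule Cn_real_SucI)
    show "times_differentiable_on n (\<lambda>x. exp (log_density x) *
          orbit_sum lam (\<lambda>x. exp (- log_density x) * deriv distortion x) x) I"
      by (intro Cn_mult Cn_compose[OF _ _ Cn_exp[OF open_UNIV]] Suc Cn_orbit_sum lam Cn_minus distortion(2)) auto
    show "(log_density has_real_derivative exp (log_density x) *
          orbit_sum lam (\<lambda>x. exp (- log_density x) * deriv distortion x) x) (at x)"
      if "x \<in> I" for x
      using orbit_sum_deriv[of distortion "deriv distortion" 1 x] distortion(1) distortion(2)[of 0] that distortion_c
      by (simp add: orbit_sum_def[abs_def] log_density_def[abs_def])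
  qed auto
qed

text \<open>Sternberg's linearization theorem in dimension one: the coordinate is the primitive of the
  exponential of \<^const>\<open>log_density\<close> that vanishes at \<open>c\<close>.\<close>
theorem linearization:
  obtains \<phi> where "\<And>n. times_differentiable_on n \<phi> I" "\<And>x. x \<in> I \<Longrightarrow> 0 < deriv \<phi> x"
    "\<phi> c = 0" "\<And>x. x \<in> I \<Longrightarrow> \<phi> (F x) = deriv F c * \<phi> x"
proof -
  have "\<exists>P. \<forall>x. ereal a < ereal x \<longrightarrow> ereal x < ereal b \<longrightarrow>
      (P has_vector_derivative exp (log_density x)) (at x)"
    by (rule einterval_antiderivative)
       (use c_in log_density_cont in \<open>auto intro!: continuous_intros simp: continuous_on_eq_continuous_at\<close>)
  then obtain P where P: "\<And>x. x \<in> I \<Longrightarrow> (P has_real_derivative exp (log_density x)) (at x)"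
    by (auto simp: has_real_derivative_iff_has_vector_derivative)
  define \<phi> where "\<phi> x = P x - P c" for x
  have \<phi>: "(\<phi> has_real_derivative exp (log_density x)) (at x)" if "x \<in> I" for x
    unfolding \<phi>_def using P[OF that] by (auto intro!: derivative_eq_intros)
  have "((\<lambda>x. \<phi> (F x) - lam * \<phi> x) has_real_derivative 0) (at x)" if x: "x \<in> I" for x
    using DERIV_diff[OF DERIV_chain2[OF \<phi>[OF F_I[OF x]] F_deriv[OF x]] DERIV_cmult[OF \<phi>[OF x], of lam]]
    by (simp add: deriv_F_distortion[OF x] log_density_eq[OF x] exp_add)
  then have "\<exists>d. \<forall>x\<in>I. \<phi> (F x) - lam * \<phi> x = d"
    by (intro has_field_derivative_zero_constant) (auto intro: has_field_derivative_at_within)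
  moreover have "\<phi> (F c) - lam * \<phi> c = 0" by (simp add: fixed \<phi>_def)
  ultimately have eq: "\<phi> (F x) = lam * \<phi> x" if "x \<in> I" for x
    using that c_I by (metis right_minus_eq)
  show ?thesis
  proof
    show "times_differentiable_on n \<phi> I" for n
    proof (rule Cn_Suc_imp, rule Cn_real_SucI[OF _ \<phi>])
      show "times_differentiable_on n (\<lambda>x. exp (log_density x)) I"
        by (intro Cn_compose[OF _ _ Cn_exp[OF open_UNIV]] Cn_log_density) auto
    qed auto
    show "0 < deriv \<phi> x" if "x \<in> I" for x using DERIV_imp_deriv[OF \<phi>[OF that]] by simp
  qed (use eq in \<open>auto simp: lam_def \<phi>_def\<close>)
qed

text \<open>Backward iteration multiplies \<open>\<phi>\<close> by \<open>1 / lam > 1\<close> and stays inside the interval, so \<open>\<phi>\<close> cannot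
  be bounded on either side of \<open>c\<close>.\<close>
lemma conjugacy_unbounded:
  assumes pos: "\<And>x. x \<in> I \<Longrightarrow> (\<phi> has_real_derivative \<phi>' x) (at x)" "\<And>x. x \<in> I \<Longrightarrow> 0 < \<phi>' x"
    and zero: "\<phi> c = 0" and conj: "\<And>x. x \<in> I \<Longrightarrow> \<phi> (F x) = lam * \<phi> x"
  obtains y z where "a < y" "y < c" "c < z" "z < b"
    "\<And>x. a < x \<Longrightarrow> x < y \<Longrightarrow> \<phi> x < - M" "\<And>x. z < x \<Longrightarrow> x < b \<Longrightarrow> M < \<phi> x"
proof -
  have mono: "\<phi> x < \<phi> y" if "x \<in> I" "y \<in> I" "x < y" for x y
    by (rule DERIV_pos_imp_increasing[OF that(3)])
       (use that in \<open>auto intro!: exI[of _ "\<phi>' _"] pos\<close>)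
  have pull: "\<exists>y\<in>I. lam ^ k * \<phi> y = \<phi> x" if "x \<in> I" for x k
  proof (induction k)
    case (Suc k)
    then obtain y where y: "y \<in> I" "lam ^ k * \<phi> y = \<phi> x" by auto
    then obtain z where "z \<in> I" "y = F z" using onto by blast
    then show ?case using y conj[of z] by (auto intro!: bexI[of _ z] simp: mult_ac)
  qed (use that in auto)
  have large: "\<exists>y\<in>I. M < \<bar>\<phi> y\<bar> \<and> sgn (\<phi> y) = sgn (\<phi> x)" if x: "x \<in> I" "\<phi> x \<noteq> 0" for x
  proof -
    have "0 < \<bar>\<phi> x\<bar> / (1 + \<bar>M\<bar>)" using x by (intro divide_pos_pos) auto
    then obtain k where k: "lam ^ k < \<bar>\<phi> x\<bar> / (1 + \<bar>M\<bar>)"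
      using real_arch_pow_inv[OF _ lam(2)] by blast
    obtain y where y: "y \<in> I" "lam ^ k * \<phi> y = \<phi> x" using pull[OF x(1)] by blast
    have l: "0 < lam ^ k" using lam by simp
    have "lam ^ k * (1 + \<bar>M\<bar>) < \<bar>\<phi> x\<bar>" using k by (simp add: divide_simps split: if_splits)
    also have "\<bar>\<phi> x\<bar> = lam ^ k * \<bar>\<phi> y\<bar>" using l by (simp flip: y(2) add: abs_mult)
    finally have "M < \<bar>\<phi> y\<bar>" using l by auto
    moreover have "sgn (\<phi> y) = sgn (\<phi> x)" using lam by (simp flip: y(2) add: sgn_mult power_sgn)
    ultimately show ?thesis using y by blast
  qed
  obtain y where y: "y \<in> I" "\<phi> y < - M" "\<phi> y < 0"
  proof -
    have "\<phi> ((a + c) / 2) < 0" using mono[of "(a + c) / 2" c] c_in zero by auto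
    then show ?thesis using large[of "(a + c) / 2"] c_in that by (force simp: sgn_if split: if_splits)
  qed
  obtain z where z: "z \<in> I" "M < \<phi> z" "0 < \<phi> z"
  proof -
    have "0 < \<phi> ((c + b) / 2)" using mono[of c "(c + b) / 2"] c_in zero by auto
    then show ?thesis using large[of "(c + b) / 2"] c_in that by (force simp: sgn_if split: if_splits)
  qed
  show ?thesis
  proof
    show "y < c" using y mono[of c y] c_in zero by (cases y c rule: linorder_cases) auto
    show "c < z" using z mono[of z c] c_in zero by (cases z c rule: linorder_cases) auto
    show "\<phi> x < - M" if "a < x" "x < y" for x using mono[of x y] that y by auto
    show "M < \<phi> x" if "z < x" "x < b" for x using mono[of z x] that z by auto
  qed (use y z in auto)
qed

end

section \<open>Lifts to the universal cover\<close>

lemma has_vector_derivative_cis: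
  assumes "(F has_real_derivative d) (at t)"
  shows "((\<lambda>t. cis (F t)) has_vector_derivative d *\<^sub>R (\<i> * cis (F t))) (at t)"
proof -
  have "((\<lambda>t. complex_of_real (F t)) has_vector_derivative of_real d) (at t)"
    using assms by (simp add: has_real_derivative_iff_has_vector_derivative has_vector_derivative_of_real)
  moreover have "((\<lambda>z. exp (\<i> * z)) has_field_derivative \<i> * exp (\<i> * of_real (F t))) (at (of_real (F t)))"
    by (auto intro!: derivative_eq_intros)
  ultimately show ?thesis
    using field_vector_diff_chain_at by (fastforce simp: o_def cis_conv_exp scaleR_conv_of_real)
qed

lemma circle_differential_lift:
  assumes g: "\<And>t. g (cis t) = cis (F t)" and F: "(F has_real_derivative d) (at s)"
  shows "circle_differential g (cis s) v = (d * Re (v / (\<i> * cis s))) *\<^sub>R (\<i> * cis (F s))"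
proof -
  have "((\<lambda>t. F (s + t)) has_real_derivative d) (at 0)"
    using F DERIV_at_within_shift[of F d s 0 UNIV] by simp
  then have "((\<lambda>t. cis (F (s + t))) has_vector_derivative d *\<^sub>R (\<i> * cis (F s))) (at 0)"
    using has_vector_derivative_cis[of "\<lambda>t. F (s + t)" d 0] by simp
  then show ?thesis
    by (simp add: circle_differential_def g cis_mult vector_derivative_at mult.commute[of d])
qed

lemma circle_deriv_lift:
  assumes "\<And>t. g (cis t) = cis (F t)" "(F has_real_derivative d) (at s)"
  shows "circle_deriv g (cis s) = d"
  by (simp add: circle_deriv_def circle_differential_lift[OF assms] assms(1) scaleR_conv_of_real)

lemma cis_eq_cis_iff: "cis a = cis b \<longleftrightarrow> (\<exists>k::int. a = b + 2 * pi * k)"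
  by (simp add: complex_eq_iff conj_commute flip: sin_cos_eq_iff)

lemma cis_inj_short: "cis a = cis b \<Longrightarrow> \<bar>a - b\<bar> < 2 * pi \<Longrightarrow> a = b"
proof -
  assume "cis a = cis b" and l: "\<bar>a - b\<bar> < 2 * pi"
  then obtain k :: int where k: "a = b + 2 * pi * k" by (auto simp: cis_eq_cis_iff)
  with l have "2 * pi * \<bar>real_of_int k\<bar> < 2 * pi * 1" by (simp add: abs_mult)
  then have "\<bar>real_of_int k\<bar> < 1" by (subst (asm) mult_less_cancel_left_pos) auto
  with k show "a = b" by simp
qed

lemma sphere_cis: "x \<in> S1 \<Longrightarrow> x = cis (Arg x)"
  using rcis_cmod_Arg[of x] by (simp add: rcis_def)

locale circle_lift =
  fixes f :: "complex \<Rightarrow> complex" and F :: "real \<Rightarrow> real"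
  assumes lift: "f (cis t) = cis (F t)"
    and smooth: "times_differentiable_on n F UNIV"
    and pos: "0 < deriv F t"
    and shift: "F (t + 2 * pi) = F t + 2 * pi"
begin

lemma deriv: "(F has_real_derivative deriv F t) (at t)"
  using Cn_real_SucD(1)[OF smooth[of 1, unfolded One_nat_def]] by auto

lemma cont: "continuous_on A F"
  using Cn_continuous[OF smooth] continuous_on_subset by blast

lemma smono: "strict_mono F"
  by (rule strict_monoI, rule DERIV_pos_imp_increasing) (auto intro!: exI[of _ "deriv F _"] deriv pos)

lemma shift_int: "F (t + 2 * pi * of_int k) = F t + 2 * pi * of_int k"
proof (induction k rule: int_induct[of _ 0])
  case (step1 i)
  then show ?case using shift[of "t + 2 * pi * of_int i"] by (simp add: algebra_simps)
next
  case (step2 i)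
  then show ?case using shift[of "t + 2 * pi * of_int (i - 1)"] by (simp add: algebra_simps)
qed simp

abbreviation (input) "Finv \<equiv> inv_into UNIV F"

lemma surj: "surj F"
proof -
  have "y \<in> range F" for y
  proof -
    obtain m :: nat where m: "\<bar>y - F 0\<bar> < 2 * pi * of_nat m"
      using reals_Archimedean3[of "2 * pi"] by (metis mult.commute pi_gt_zero zero_less_mult_iff zero_less_numeral)
    have "F (- (2 * pi * m)) \<le> y" "y \<le> F (2 * pi * m)"
      using m shift_int[of 0 "- int m"] shift_int[of 0 "int m"] by auto
    then show ?thesis
      using IVT'[of F "- (2 * pi * m)" y "2 * pi * m"] cont by auto
  qed
  then show ?thesis by auto
qed

lemma bij: "bij F" using surj smono by (simp add: bij_def strict_mono_imp_inj_on)

lemma Finv [simp]: "F (Finv t) = t" "Finv (F t) = t"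
  using bij by (auto simp: bij_def surj_f_inv_f)

lemma Finv_deriv: "(Finv has_real_derivative inverse (deriv F (Finv t))) (at t)"
proof -
  have "isCont Finv (F (Finv t))"
    by (rule isCont_inverse_function[where d=1])
       (auto intro: continuous_on_interior[OF cont[of UNIV]])
  then have "isCont Finv t" by simp
  then show ?thesis
    by (intro DERIV_inverse_function[where f=F and a="t - 1" and b="t + 1"] deriv)
       (use pos[of "Finv t"] in auto)
qed

lemma Cn_inv: "times_differentiable_on n (Finv) UNIV"
proof (induction n)
  case 0
  show ?case using Finv_deriv DERIV_isCont by (auto intro!: continuous_at_imp_continuous_on)
next
  case (Suc n)
  have "times_differentiable_on n (\<lambda>t. deriv F (Finv t)) UNIV"
    by (rule Cn_compose[OF _ Suc Cn_real_SucD(2)[OF smooth]]) auto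
  then have "times_differentiable_on n (\<lambda>t. inverse (deriv F (Finv t))) UNIV"
    by (rule Cn_compose[OF open_UNIV _ Cn_inverse]) (use pos less_imp_neq in fastforce)
  then show ?case by (rule Cn_real_SucI[OF open_UNIV Finv_deriv])
qed

lemma inv_lift:
  assumes "inj_on f S1" shows "circle_lift (inv_into S1 f) (Finv)"
proof
  show "inv_into S1 f (cis t) = cis (Finv t)" for t
    using assms lift[of "Finv t"] by (intro inv_into_f_eq) auto
  show "Finv (t + 2 * pi) = Finv t + 2 * pi" for t
    by (metis Finv shift)
  show "0 < deriv (Finv) t" for t
    using DERIV_imp_deriv[OF Finv_deriv] pos by simp
qed (rule Cn_inv)

end

text \<open>The lift is the primitive of the angular velocity of \<open>t \<mapsto> f (cis t)\<close>, so it is smooth without any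
  covering theory. It advances by a multiple of \<open>2 * pi\<close> over one turn; injectivity of \<open>f\<close>
  excludes every multiple but the first.\<close>
theorem Diff_S1_lift:
  assumes f: "f \<in> Diff_S1" and s: "f (cis s) = cis s"
  obtains F where "circle_lift f F" "F s = s"
proof -
  have inj: "inj_on f S1" and pos: "\<And>x. x \<in> S1 \<Longrightarrow> 0 < circle_deriv f x"
    and into: "f ` S1 \<subseteq> S1"
    and sm: "\<And>n. times_differentiable_on n (\<lambda>t. f (cis t)) UNIV"
    using f by (auto simp: Diff_S1_def Bij_def bij_betw_def smooth_circle_map_def smooth_on_def)
  define \<gamma> where "\<gamma> t = f (cis t)" for t :: real
  define \<gamma>' where "\<gamma>' t = frechet_derivative \<gamma> (at t) 1" for t
  have td: "times_differentiable_on n \<gamma> UNIV" for n using sm by (simp add: \<gamma>_def[abs_def])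
  have td': "times_differentiable_on n \<gamma>' UNIV" for n
    using Cn_SucD(2)[OF td] by (simp add: \<gamma>'_def[abs_def])
  have norm: "norm (\<gamma> t) = 1" for t using into by (force simp: \<gamma>_def)
  have \<gamma>': "(\<gamma> has_vector_derivative \<gamma>' t) (at t)" for t
  proof -
    have "\<gamma> differentiable (at t)" using td[of "Suc 0"] by simp
    then show ?thesis
      by (simp add: \<gamma>'_def frechet_derivative_eq_vector_derivative vector_derivative_works)
  qed
  define a where "a t = Im (\<gamma>' t) * Re (\<gamma> t) - Re (\<gamma>' t) * Im (\<gamma> t)" for t
  have Cn_a: "times_differentiable_on n a UNIV" for n
    unfolding a_def[abs_def]
    by (intro Cn_diff Cn_mult Cn_linear_comp[of Re] Cn_linear_comp[of Im] td td' open_UNIV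
          bounded_linear_Re bounded_linear_Im)
  have "\<exists>A. \<forall>t. -\<infinity> < ereal t \<longrightarrow> ereal t < \<infinity> \<longrightarrow> (A has_vector_derivative a t) (at t)"
    by (rule einterval_antiderivative)
       (use Cn_continuous[OF Cn_a] in \<open>auto simp: continuous_on_eq_continuous_at\<close>)
  then obtain A where A: "\<And>t. (A has_real_derivative a t) (at t)"
    by (auto simp: has_real_derivative_iff_has_vector_derivative)
  define F where "F t = A t - A s + s" for t
  have F: "(F has_real_derivative a t) (at t)" for t
    unfolding F_def using A by (auto intro!: derivative_eq_intros)
  have Re': "((\<lambda>t. Re (\<gamma> t)) has_real_derivative Re (\<gamma>' t)) (at t)"
    and Im': "((\<lambda>t. Im (\<gamma> t)) has_real_derivative Im (\<gamma>' t)) (at t)" for t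
    unfolding has_real_derivative_iff_has_vector_derivative
    by (rule bounded_linear.has_vector_derivative[OF _ \<gamma>'[of t]],
        simp add: bounded_linear_Re bounded_linear_Im)+
  have sq: "(Re (\<gamma> t))\<^sup>2 + (Im (\<gamma> t))\<^sup>2 = 1" for t
    using norm[of t] by (simp add: cmod_def)
  have tangent: "\<gamma>' t = of_real (a t) * \<i> * \<gamma> t" for t
  proof -
    have "((\<lambda>t. (Re (\<gamma> t))\<^sup>2 + (Im (\<gamma> t))\<^sup>2) has_real_derivative
            2 * (Re (\<gamma> t) * Re (\<gamma>' t) + Im (\<gamma> t) * Im (\<gamma>' t))) (at t)"
      by (auto intro!: derivative_eq_intros Re' Im' \<gamma>' simp: algebra_simps)
    then have "((\<lambda>t. 1) has_real_derivative
            2 * (Re (\<gamma> t) * Re (\<gamma>' t) + Im (\<gamma> t) * Im (\<gamma>' t))) (at t)"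
      by (simp only: sq)
    from DERIV_unique[OF this DERIV_const]
    have z: "Re (\<gamma> t) * Re (\<gamma>' t) + Im (\<gamma> t) * Im (\<gamma>' t) = 0"
      by simp
    have "Re (\<gamma>' t) = - a t * Im (\<gamma> t)" "Im (\<gamma>' t) = a t * Re (\<gamma> t)"
      using sq[of t] z unfolding a_def power2_eq_square by algebra+
    then show ?thesis by (simp add: complex_eq_iff)
  qed
  have "((\<lambda>t. \<gamma> t * cis (- F t)) has_vector_derivative 0) (at t)" for t
  proof -
    have "((\<lambda>t. cis (- F t)) has_vector_derivative (- a t) *\<^sub>R (\<i> * cis (- F t))) (at t)"
      by (rule has_vector_derivative_cis) (auto intro!: derivative_eq_intros F)
    from has_vector_derivative_mult[OF \<gamma>'[of t] this] show ?thesis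
      by (simp add: tangent scaleR_conv_of_real algebra_simps)
  qed
  then have "\<gamma> t * cis (- F t) = \<gamma> s * cis (- F s)" for t
    using has_vector_derivative_zero_constant[of UNIV "\<lambda>t. \<gamma> t * cis (- F t)"]
    by (metis UNIV_I convex_UNIV)
  then have one: "\<gamma> t * cis (- F t) = 1" for t
    using s by (simp add: \<gamma>_def F_def cis_mult)
  have lift: "f (cis t) = cis (F t)" for t
  proof -
    have "\<gamma> t * (cis (- F t) * cis (F t)) = cis (F t)" using one[of t] by (simp flip: mult.assoc)
    then show ?thesis by (simp add: cis_mult \<gamma>_def)
  qed
  have apos: "0 < a t" for t
    using pos[of "cis t"] circle_deriv_lift[OF lift F] by simp
  have smono: "F x < F y" if "x < y" for x y
    by (rule DERIV_pos_imp_increasing[OF that]) (auto intro!: exI[of _ "a _"] F apos)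
  have cont: "continuous_on X F" for X
    using F DERIV_isCont by (auto intro!: continuous_at_imp_continuous_on)
  have shift: "F (t + 2 * pi) = F t + 2 * pi" for t
  proof -
    have "cis (F (t + 2 * pi)) = cis (F t)" by (simp flip: lift cis_mult)
    then obtain k :: int where k: "F (t + 2 * pi) = F t + 2 * pi * k" by (auto simp: cis_eq_cis_iff)
    have "F t < F (t + 2 * pi)" by (rule smono) simp
    with k have "0 < k" by (simp add: zero_less_mult_iff)
    moreover have "\<not> 2 \<le> k"
    proof
      assume "2 \<le> k"
      then have "2 * pi * 1 < 2 * pi * k" by (subst mult_less_cancel_left_pos) auto
      then have "F t \<le> F t + 2 * pi" "F t + 2 * pi \<le> F (t + 2 * pi)" using k by auto
      then obtain u where u: "t \<le> u" "u \<le> t + 2 * pi" "F u = F t + 2 * pi"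
        using IVT'[of F t "F t + 2 * pi" "t + 2 * pi"] cont by auto
      then have "f (cis u) = f (cis t)" by (simp add: lift flip: cis_mult)
      then have "cis u = cis t" using inj by (auto simp: inj_on_def)
      moreover have "u \<noteq> t + 2 * pi" "u \<noteq> t" using u k \<open>2 * pi * 1 < 2 * pi * k\<close> by auto
      ultimately show False using cis_inj_short[of u t] u by auto
    qed
    ultimately have "k = 1" by simp
    then show ?thesis using k by simp
  qed
  have "circle_lift f F"
  proof
    show "times_differentiable_on n F UNIV" for n
      by (rule Cn_Suc_imp, rule Cn_real_SucI[OF open_UNIV F Cn_a])
  qed (use lift apos shift DERIV_imp_deriv[OF F] in auto)
  then show ?thesis by (rule that) (simp add: F_def)
qed

section \<open>Area-preservation in terms of a density on the plane\<close>

text \<open>Periodicity of \<open>w\<close> is expressed through \<^const>\<open>cis\<close>, because the values of \<open>w\<close> matter only as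
  a function of two points of the circle.\<close>
definition invariant_density :: "(real \<Rightarrow> real) \<Rightarrow> (real \<Rightarrow> real \<Rightarrow> real) \<Rightarrow> bool" where
  "invariant_density F w \<longleftrightarrow>
     (\<forall>n. times_differentiable_on n (\<lambda>(s, t). w s t) {(s, t). cis s \<noteq> cis t}) \<and>
     (\<forall>s t s' t'. cis s = cis s' \<longrightarrow> cis t = cis t' \<longrightarrow> w s t = w s' t') \<and>
     (\<forall>s t. cis s \<noteq> cis t \<longrightarrow> w s t \<noteq> 0 \<and> w (F s) (F t) * deriv F s * deriv F t = w s t)"

context circle_lift
begin

lemma cis_F_iff: "cis (F x) = cis (F y) \<longleftrightarrow> cis x = cis y"
proof -
  have "(F x = F y + 2 * pi * of_int k) = (x = y + 2 * pi * of_int k)" for k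
    using strict_mono_eq[OF smono, of x "y + 2 * pi * of_int k"] by (simp add: shift_int)
  then show ?thesis by (simp add: cis_eq_cis_iff)
qed

lemma deriv_shift: "deriv F (t + 2 * pi * of_int k) = deriv F t"
proof (rule DERIV_unique)
  show "((\<lambda>x. F (x + 2 * pi * of_int k)) has_real_derivative deriv F (t + 2 * pi * of_int k)) (at t)"
    using DERIV_at_within_shift[of F "deriv F (t + 2 * pi * of_int k)" "2 * pi * of_int k" t UNIV]
      deriv[of "t + 2 * pi * of_int k"]
    by (simp add: add.commute)
  show "((\<lambda>x. F (x + 2 * pi * of_int k)) has_real_derivative deriv F t) (at t)"
    unfolding shift_int by (auto intro!: derivative_eq_intros deriv)
qed

lemma differential_basis:
  "circle_differential f (cis s) (a *\<^sub>R (\<i> * cis s)) = (a * deriv F s) *\<^sub>R (\<i> * cis (F s))"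
  by (subst circle_differential_lift[OF lift deriv]) (simp add: scaleR_conv_of_real mult.commute)

text \<open>The form is \<open>w ds \<and> dt\<close>, with \<open>ds\<close> read off a tangent vector \<open>u\<close> at \<open>x\<close> as \<open>Re (u / (\<i> * x))\<close>.
  Periodicity of \<open>w\<close> makes the choice of \<^const>\<open>Arg\<close> for the angle harmless.\<close>
lemma density_imp_area_preserving:
  assumes "invariant_density F w" shows "area_preserving f"
proof -
  define co where "co x u = Re (u / (\<i> * x))" for x u :: complex
  define \<omega> where "\<omega> p u v = w (Arg (fst p)) (Arg (snd p)) *
      (co (fst p) (fst u) * co (snd p) (snd v) - co (fst p) (fst v) * co (snd p) (snd u))"
    for p u v :: "complex \<times> complex"
  have w: "\<And>n. times_differentiable_on n (\<lambda>(s, t). w s t) {(s, t). cis s \<noteq> cis t}"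
    "\<And>s t s' t'. cis s = cis s' \<Longrightarrow> cis t = cis t' \<Longrightarrow> w s t = w s' t'"
    "\<And>s t. cis s \<noteq> cis t \<Longrightarrow> w s t \<noteq> 0"
    "\<And>s t. cis s \<noteq> cis t \<Longrightarrow> w (F s) (F t) * deriv F s * deriv F t = w s t"
    using assms unfolding invariant_density_def by blast+
  have cisArg: "cis (Arg (cis t)) = cis t" for t
    using sphere_cis[of "cis t"] by simp
  have wArg: "w (Arg (cis s)) (Arg (cis t)) = w s t" for s t
    by (rule w(2)) (simp_all add: cisArg)
  have co_basis: "co (cis s) (a *\<^sub>R (\<i> * cis s)) = a" for a s
    by (simp add: co_def scaleR_conv_of_real)
  have off: "\<exists>s t. p = (cis s, cis t) \<and> cis s \<noteq> cis t" if p: "p \<in> off_diagonal" for p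
  proof -
    obtain x y where "p = (x, y)" "x \<in> S1" "y \<in> S1" "x \<noteq> y" using p by (auto simp: off_diagonal_def)
    then show ?thesis using sphere_cis by metis
  qed
  have "smooth_volume_form \<omega>"
    unfolding smooth_volume_form_def
  proof (intro conjI ballI)
    show "alternating_two_form \<omega>"
      unfolding alternating_two_form_def
    proof (intro ballI conjI allI)
      have co: "co x (a *\<^sub>R u + b *\<^sub>R v) = a * co x u + b * co x v" for x u v a b
        by (simp add: co_def add_divide_distrib scaleR_conv_of_real flip: times_divide_eq_right)
      show "\<omega> p (a *\<^sub>R u + b *\<^sub>R v) w' = a * \<omega> p u w' + b * \<omega> p v w'" for p u v w' a b
        by (simp add: \<omega>_def co algebra_simps)
    qed (simp add: \<omega>_def algebra_simps)
    show "smooth_two_form \<omega>"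
      unfolding smooth_two_form_def smooth_on_def
      using w(1) co_basis[of _ 1] by (simp add: \<omega>_def wArg co_def)
    fix p assume "p \<in> off_diagonal"
    then obtain s t where p: "p = (cis s, cis t)" "cis s \<noteq> cis t" using off by blast
    have "\<omega> p (\<i> * cis s, 0) (0, \<i> * cis t) \<noteq> 0"
      using w(3)[OF p(2)] co_basis[of _ 1] by (simp add: p(1) \<omega>_def wArg co_def)
    moreover have "(\<i> * cis s, 0) \<in> tangent_off_diagonal p" "(0, \<i> * cis t) \<in> tangent_off_diagonal p"
      by (auto simp: p(1) tangent_off_diagonal_def tangent_circle_def
          intro: range_eqI[of _ _ 1] range_eqI[of _ _ 0])
    ultimately show "\<exists>u\<in>tangent_off_diagonal p. \<exists>v\<in>tangent_off_diagonal p. \<omega> p u v \<noteq> 0"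
      by blast
  qed
  moreover have "diagonal_preserves f \<omega>"
    unfolding diagonal_preserves_def
  proof (intro ballI)
    fix p u v assume "p \<in> off_diagonal"
      and uv: "u \<in> tangent_off_diagonal p" "v \<in> tangent_off_diagonal p"
    then obtain s t where p: "p = (cis s, cis t)" "cis s \<noteq> cis t" using off by blast
    obtain a b c d where u: "u = (a *\<^sub>R (\<i> * cis s), b *\<^sub>R (\<i> * cis t))"
      and v: "v = (c *\<^sub>R (\<i> * cis s), d *\<^sub>R (\<i> * cis t))"
      using uv by (auto simp: p(1) tangent_off_diagonal_def tangent_circle_def)
    have "\<omega> (map_prod f f p) (diagonal_differential f p u) (diagonal_differential f p v) =
        w (F s) (F t) * deriv F s * deriv F t * (a * d - c * b)"
      by (simp add: p(1) u v diagonal_differential_def differential_basis lift \<omega>_def co_basis wArg algebra_simps)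
    also have "\<dots> = \<omega> p u v"
      by (simp add: w(4)[OF p(2)]) (simp add: p(1) u v \<omega>_def co_basis wArg)
    finally show "\<omega> (map_prod f f p) (diagonal_differential f p u) (diagonal_differential f p v) = \<omega> p u v" .
  qed
  ultimately show ?thesis unfolding area_preserving_def by blast
qed

text \<open>The density is the coefficient of the form in the frame of angular vector fields. On pairs
  of tangent vectors the form is this coefficient times a \<open>2 \<times> 2\<close> determinant, which gives
  nonvanishing as well as the transformation rule.\<close>
lemma area_preserving_imp_density:
  assumes "area_preserving f" obtains w where "invariant_density F w"
proof -
  obtain \<omega> where \<omega>: "smooth_volume_form \<omega>" "diagonal_preserves f \<omega>"
    using assms by (auto simp: area_preserving_def)
  define e1 e2 :: "real \<Rightarrow> complex \<times> complex" where "e1 s = (\<i> * cis s, 0)" and "e2 t = (0, \<i> * cis t)" for s t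
  define w where "w s t = \<omega> (cis s, cis t) (e1 s) (e2 t)" for s t
  define X where "X s t = tangent_off_diagonal (cis s, cis t)" for s t
  have off: "(cis s, cis t) \<in> off_diagonal" if "cis s \<noteq> cis t" for s t
    using that by (simp add: off_diagonal_def)
  have X: "a *\<^sub>R e1 s + b *\<^sub>R e2 t \<in> X s t" for a b s t
    by (auto simp: X_def e1_def e2_def tangent_off_diagonal_def tangent_circle_def)
  have X1: "a *\<^sub>R e1 s \<in> X s t" and X2: "a *\<^sub>R e2 t \<in> X s t" for a s t
    using X[of a s 0 t] X[of 0 s a t] by auto
  have e: "e1 s \<in> X s t" "e2 t \<in> X s t" for s t using X1[of 1] X2[of 1] by auto
  have alt: "\<omega> (cis s, cis t) v u = - \<omega> (cis s, cis t) u v"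
    and lin: "\<omega> (cis s, cis t) (a *\<^sub>R u + b *\<^sub>R v) z = a * \<omega> (cis s, cis t) u z + b * \<omega> (cis s, cis t) v z"
    if "cis s \<noteq> cis t" "u \<in> X s t" "v \<in> X s t" "z \<in> X s t" for s t u v z a b
    using \<omega>(1) off[OF that(1)] that(2-)
    unfolding smooth_volume_form_def alternating_two_form_def X_def by blast+
  have coords: "\<omega> (cis s, cis t) (a *\<^sub>R e1 s + b *\<^sub>R e2 t) (c *\<^sub>R e1 s + d *\<^sub>R e2 t) = (a * d - b * c) * w s t"
    if st: "cis s \<noteq> cis t" for s t a b c d
  proof -
    have z: "\<omega> (cis s, cis t) u u = 0" if "u \<in> X s t" for u
      using alt[OF st that that that] by simp
    have "\<omega> (cis s, cis t) (e1 s) (c *\<^sub>R e1 s + d *\<^sub>R e2 t) = d * w s t"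
      using alt[OF st X[of c s d t] e(1) e(1)] lin[OF st e(1) e(2) e(1), of c d]
        alt[OF st e(1) e(2) e(1)] z[OF e(1)] by (simp add: w_def)
    moreover have "\<omega> (cis s, cis t) (e2 t) (c *\<^sub>R e1 s + d *\<^sub>R e2 t) = - c * w s t"
      using alt[OF st X[of c s d t] e(2) e(1)] lin[OF st e(1) e(2) e(2), of c d] z[OF e(2)]
      by (simp add: w_def)
    ultimately show ?thesis
      using lin[OF st e X[of c s d t], of a b] by (simp add: algebra_simps)
  qed
  have "invariant_density F w"
    unfolding invariant_density_def
  proof (intro conjI allI impI)
    show "times_differentiable_on n (\<lambda>(s, t). w s t) {(s, t). cis s \<noteq> cis t}" for n
      using \<omega>(1) unfolding smooth_volume_form_def smooth_two_form_def smooth_on_def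
      by (simp add: w_def e1_def e2_def)
    show "w s t = w s' t'" if "cis s = cis s'" "cis t = cis t'" for s t s' t'
      using that by (simp add: w_def e1_def e2_def)
    fix s t assume st: "cis s \<noteq> cis t"
    show "w s t \<noteq> 0"
    proof
      assume w0: "w s t = 0"
      obtain u v where uv: "u \<in> X s t" "v \<in> X s t" "\<omega> (cis s, cis t) u v \<noteq> 0"
        using \<omega>(1) off[OF st] unfolding smooth_volume_form_def X_def by blast
      have decomp: "\<exists>a b. u = a *\<^sub>R e1 s + b *\<^sub>R e2 t" if "u \<in> X s t" for u
        using that by (auto simp: X_def e1_def e2_def tangent_off_diagonal_def tangent_circle_def)
      obtain a b where u: "u = a *\<^sub>R e1 s + b *\<^sub>R e2 t" using decomp[OF uv(1)] by blast
      obtain c d where v: "v = c *\<^sub>R e1 s + d *\<^sub>R e2 t" using decomp[OF uv(2)] by blast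
      show False using uv(3) coords[OF st, of a b c d] by (simp add: u v w0)
    qed
    have st': "cis (F s) \<noteq> cis (F t)" using st by (simp add: cis_F_iff)
    have "w s t = \<omega> (map_prod f f (cis s, cis t))
        (diagonal_differential f (cis s, cis t) (e1 s)) (diagonal_differential f (cis s, cis t) (e2 t))"
      using \<omega>(2) off[OF st] e(1)[where s=s and t=t] e(2)[where s=s and t=t]
      unfolding diagonal_preserves_def X_def w_def by (metis (no_types))
    also have "\<dots> = \<omega> (cis (F s), cis (F t)) (deriv F s *\<^sub>R e1 (F s)) (deriv F t *\<^sub>R e2 (F t))"
      using differential_basis[of s 1] differential_basis[of t 1]
        differential_basis[of s 0] differential_basis[of t 0]
      by (simp add: diagonal_differential_def e1_def e2_def lift)
    also have "\<dots> = w (F s) (F t) * deriv F s * deriv F t"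
      using coords[OF st', of "deriv F s" 0 0 "deriv F t"] by simp
    finally show "w (F s) (F t) * deriv F s * deriv F t = w s t" ..
  qed
  then show ?thesis by (rule that)
qed

end

section \<open>Linearization on the circle minus a fixed point\<close>

text \<open>The representative of \<open>t\<close> modulo \<open>2 * pi\<close> in \<open>[s, s + 2 * pi)\<close>.\<close>
definition wrap :: "real \<Rightarrow> real \<Rightarrow> real" where
  "wrap s t = t - 2 * pi * \<lfloor>(t - s) / (2 * pi)\<rfloor>"

lemma wrap_range: "s \<le> wrap s t" "wrap s t < s + 2 * pi"
proof -
  define m where "m = \<lfloor>(t - s) / (2 * pi)\<rfloor>"
  have "of_int m \<le> (t - s) / (2 * pi)" "(t - s) / (2 * pi) < of_int m + 1"
    unfolding m_def by linarith+
  then show "s \<le> wrap s t" "wrap s t < s + 2 * pi"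
    unfolding wrap_def m_def[symmetric] by (auto simp: field_simps)
qed

lemma wrap_shift: obtains k :: int where "t = wrap s t + 2 * pi * k"
  by (simp add: wrap_def)

lemma cis_wrap [simp]: "cis (wrap s t) = cis t"
  using wrap_shift[of t s] cis_eq_cis_iff by metis

lemma wrap_eq_iff: "wrap s t = u \<longleftrightarrow> s \<le> u \<and> u < s + 2 * pi \<and> cis t = cis u"
  using wrap_range[of s t] cis_inj_short[of "wrap s t" u] by auto

lemma wrap_cong: "cis t = cis u \<Longrightarrow> wrap s t = wrap s u"
  using wrap_range by (simp add: wrap_eq_iff)

text \<open>Reduction modulo \<open>2 * pi\<close> jumps at the lifts of \<open>cis s\<close> and is a translation near every other
  point.\<close>
lemma Cn_wrap:
  fixes g :: "real \<Rightarrow> real"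
  assumes g: "times_differentiable_on n g {s<..<s + 2 * pi}"
  shows "times_differentiable_on n (\<lambda>t. g (wrap s t)) {t. cis t \<noteq> cis s}"
proof (rule Cn_local)
  fix t assume "t \<in> {t. cis t \<noteq> cis s}"
  then have ne: "wrap s t \<noteq> s" by (auto simp: wrap_eq_iff)
  obtain k :: int where k: "t = wrap s t + 2 * pi * k" by (rule wrap_shift)
  define V where "V = {s + 2 * pi * k<..<s + 2 * pi + 2 * pi * k}"
  have wrap: "wrap s u = u - 2 * pi * k" if "u \<in> V" for u
    using that unfolding wrap_eq_iff V_def
    by (auto simp: cis_eq_cis_iff intro: exI[of _ k])
  have "times_differentiable_on n (\<lambda>u. u - 2 * pi * k) V"
    unfolding V_def
    by (intro Cn_diff Cn_const Cn_bounded_linear_id bounded_linear_ident) auto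
  then have "times_differentiable_on n (\<lambda>u. g (u - 2 * pi * k)) V"
    by (intro Cn_compose[OF _ _ g]) (auto simp: V_def)
  then have "times_differentiable_on n (\<lambda>u. g (wrap s u)) V"
    by (rule Cn_cong[rotated 2]) (auto simp: wrap, simp add: V_def)
  moreover have "t \<in> V" using ne wrap_range[of s t] k by (auto simp: V_def)
  ultimately show "\<exists>V. open V \<and> t \<in> V \<and> times_differentiable_on n (\<lambda>t. g (wrap s t)) V"
    by (intro exI[of _ V]) (auto simp: V_def)
qed

text \<open>On the universal cover: \<open>n\<close> attracts every point between the two neighbouring lifts \<open>s\<close> and
  \<open>s + 2 * pi\<close> of the other fixed point.\<close>
locale circle_contraction = circle_lift +
  fixes s n :: real
  assumes between: "s < n" "n < s + 2 * pi"
    and fixed: "F s = s" "F n = n"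
    and only_fixed: "\<And>t. s < t \<Longrightarrow> t < s + 2 * pi \<Longrightarrow> F t = t \<Longrightarrow> t = n"
    and attracting: "deriv F n < 1"
begin

lemma F_less_iff: "F x < F y \<longleftrightarrow> x < y" and F_le_iff: "F x \<le> F y \<longleftrightarrow> x \<le> y"
  using smono strict_mono_less strict_mono_less_eq by blast+

lemma wrap_F: "wrap s (F t) = F (wrap s t)"
  unfolding wrap_eq_iff
  using F_le_iff[of s "wrap s t"] F_less_iff[of "wrap s t" "s + 2 * pi"] fixed shift[of s] wrap_range[of s t]
  by (auto simp: cis_F_iff)

lemma contraction: "interval_contraction F s (s + 2 * pi) n"
proof
  show "F ` {s<..<s + 2 * pi} = {s<..<s + 2 * pi}"
  proof (intro Set.set_eqI iffI)
    fix y assume "y \<in> F ` {s<..<s + 2 * pi}"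
    then show "y \<in> {s<..<s + 2 * pi}"
      using fixed shift[of s] F_less_iff by (metis (no_types, lifting) greaterThanLessThan_iff imageE)
  next
    fix y assume y: "y \<in> {s<..<s + 2 * pi}"
    obtain x where x: "y = F x" using surj by (metis surjD)
    have "x \<in> {s<..<s + 2 * pi}"
      using y x fixed shift[of s] F_less_iff by (metis greaterThanLessThan_iff)
    then show "y \<in> F ` {s<..<s + 2 * pi}" using x by blast
  qed
  show "times_differentiable_on m F {s<..<s + 2 * pi}" for m
    by (rule Cn_subset[OF smooth]) auto
  show "x = n" if "x \<in> {s<..<s + 2 * pi}" "F x = x" for x
    using only_fixed[of x] that by auto
qed (simp_all add: between fixed pos attracting)

sublocale C: interval_contraction F s "s + 2 * pi" n by (rule contraction)

text \<open>Here \<open>a\<close> is the derivative of the linearizing coordinate \<open>\<phi>\<close>. Both are periodic functions on the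
  line that are smooth away from the lifts of \<open>s\<close> and are given the value \<open>0\<close> there; with this
  value the equivariance relations hold everywhere. The last clause says that \<open>\<bar>\<phi>\<bar>\<close>
  tends to infinity at these points.\<close>
theorem circle_linearization:
  obtains \<phi> a :: "real \<Rightarrow> real" where
    "\<And>t u. cis t = cis u \<Longrightarrow> \<phi> t = \<phi> u" "\<And>t u. cis t = cis u \<Longrightarrow> a t = a u"
    "\<And>m. times_differentiable_on m \<phi> {t. cis t \<noteq> cis s}"
    "\<And>m. times_differentiable_on m a {t. cis t \<noteq> cis s}"
    "\<And>t. cis t \<noteq> cis s \<Longrightarrow> 0 < a t" "\<And>t. cis t = cis s \<Longrightarrow> a t = 0"
    "\<And>t. \<phi> t = 0 \<longleftrightarrow> cis t = cis n \<or> cis t = cis s"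
    "\<And>t. \<phi> (F t) = deriv F n * \<phi> t" "\<And>t. a (F t) * deriv F t = deriv F n * a t"
    "\<And>t M. cis t = cis s \<Longrightarrow> eventually (\<lambda>u. M < \<bar>\<phi> u\<bar>) (at t)"
proof -
  let ?I = "{s<..<s + 2 * pi}"
  obtain P where P: "\<And>n. times_differentiable_on n P ?I" "\<And>x. x \<in> ?I \<Longrightarrow> 0 < deriv P x"
    "P n = 0" "\<And>x. x \<in> ?I \<Longrightarrow> P (F x) = deriv F n * P x"
    using C.linearization by blast
  have dP: "(P has_real_derivative deriv P x) (at x)" if "x \<in> ?I" for x
    using Cn_real_SucD(1)[OF P(1)[of "Suc 0"]] that by auto
  have tdP: "times_differentiable_on m (deriv P) ?I" for m
    by (rule Cn_real_SucD(2)[OF P(1)]) auto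
  have mono: "P x < P y" if "x \<in> ?I" "y \<in> ?I" "x < y" for x y
    by (rule DERIV_pos_imp_increasing[OF that(3)])
       (use that in \<open>auto intro!: exI[of _ "deriv P _"] P dP\<close>)
  have dPF: "deriv P (F x) * deriv F x = deriv F n * deriv P x" if x: "x \<in> ?I" for x
  proof -
    have "((\<lambda>x. P (F x)) has_real_derivative deriv F n * deriv P x) (at x)"
      by (rule has_field_derivative_transform_within_open[OF DERIV_cmult[OF dP[OF x], of "deriv F n"], of ?I])
         (use x P(4) in auto)
    from DERIV_unique[OF DERIV_chain2[OF dP[OF C.F_I[OF x]] deriv] this]
    show ?thesis .
  qed
  define ext where "ext G t = (if wrap s t = s then 0 else G (wrap s t))" for G :: "real \<Rightarrow> real" and t
  have wrap_s: "wrap s t = s \<longleftrightarrow> cis t = cis s" for t by (simp add: wrap_eq_iff)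
  have wrap_I: "wrap s t \<in> ?I" if "cis t \<noteq> cis s" for t
    using wrap_range[of s t] that wrap_s[of t] by (auto simp: le_less)
  have ext: "ext G t = 0" if "cis t = cis s" for G t using that by (simp add: ext_def wrap_s)
  have ext': "ext G t = G (wrap s t)" if "cis t \<noteq> cis s" for G t using that by (simp add: ext_def wrap_s)
  have opn: "open {t. cis t \<noteq> cis s}"
    by (intro open_Collect_neq continuous_intros)
  have Cn_ext: "times_differentiable_on m (ext G) {t. cis t \<noteq> cis s}"
    if "times_differentiable_on m G ?I" for m G
    by (rule Cn_cong[OF opn _ Cn_wrap[OF that]]) (simp add: ext')
  have Fs: "cis (F t) = cis s \<longleftrightarrow> cis t = cis s" for t
    using cis_F_iff[of t s] fixed by simp
  show ?thesis
  proof (rule that[of "ext P" "ext (deriv P)"])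
    show "ext P t = ext P u" "ext (deriv P) t = ext (deriv P) u" if "cis t = cis u" for t u
      using wrap_cong[OF that] by (simp_all add: ext_def)
    show "times_differentiable_on m (ext P) {t. cis t \<noteq> cis s}"
      "times_differentiable_on m (ext (deriv P)) {t. cis t \<noteq> cis s}" for m
      by (rule Cn_ext[OF P(1)], rule Cn_ext[OF tdP])
    show "0 < ext (deriv P) t" if "cis t \<noteq> cis s" for t
      using P(2)[OF wrap_I[OF that]] by (simp add: ext' that)
    show "ext (deriv P) t = 0" if "cis t = cis s" for t using that by (rule ext)
    show "ext P t = 0 \<longleftrightarrow> cis t = cis n \<or> cis t = cis s" for t
    proof (cases "cis t = cis s")
      case False
      have "P (wrap s t) = 0 \<longleftrightarrow> wrap s t = n"
        using mono[OF wrap_I[OF False] C.c_I] mono[OF C.c_I wrap_I[OF False]] P(3)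
        by (cases "wrap s t" n rule: linorder_cases) auto
      also have "\<dots> \<longleftrightarrow> cis t = cis n" using between by (simp add: wrap_eq_iff)
      finally show ?thesis using False by (simp add: ext')
    qed (simp add: ext)
    show "ext P (F t) = deriv F n * ext P t" for t
      using P(4)[OF wrap_I[of t]] by (cases "cis t = cis s") (simp_all add: ext ext' Fs wrap_F)
    show "ext (deriv P) (F t) * deriv F t = deriv F n * ext (deriv P) t" for t
    proof (cases "cis t = cis s")
      case False
      obtain k :: int where k: "t = wrap s t + 2 * pi * k" by (rule wrap_shift)
      have "deriv F t = deriv F (wrap s t)" using deriv_shift[of "wrap s t" k] k by simp
      then show ?thesis using dPF[OF wrap_I[OF False]] False by (simp add: ext' Fs wrap_F)
    qed (simp add: ext Fs)
    fix t M assume t: "cis t = cis s"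
    obtain y z where yz: "s < y" "y < n" "n < z" "z < s + 2 * pi"
      "\<And>x. s < x \<Longrightarrow> x < y \<Longrightarrow> P x < - M" "\<And>x. z < x \<Longrightarrow> x < s + 2 * pi \<Longrightarrow> M < P x"
      using C.conjugacy_unbounded[OF dP P(2,3), where M=M] P(4) by (auto simp: C.lam_def)
    obtain k :: int where k: "t = s + 2 * pi * k" using t by (auto simp: cis_eq_cis_iff)
    show "eventually (\<lambda>u. M < \<bar>ext P u\<bar>) (at t)"
      unfolding eventually_at
    proof (intro exI[of _ "min (y - s) (s + 2 * pi - z)"] conjI ballI impI)
      fix u assume u: "u \<noteq> t \<and> dist u t < min (y - s) (s + 2 * pi - z)"
      then have ne: "cis u \<noteq> cis s"
        using cis_inj_short[of u t] t yz by (auto simp: dist_real_def)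
      show "M < \<bar>ext P u\<bar>"
      proof (cases "t < u")
        case True
        then have w: "wrap s u = u - 2 * pi * k"
          using u k yz unfolding wrap_eq_iff
          by (auto simp: dist_real_def cis_eq_cis_iff intro: exI[of _ k])
        show ?thesis using yz(5)[of "u - 2 * pi * k"] True u k
          unfolding ext'[OF ne] w by (auto simp: dist_real_def)
      next
        case False
        then have w: "wrap s u = u - 2 * pi * of_int (k - 1)"
          using u k yz unfolding wrap_eq_iff cis_eq_cis_iff
          by (intro conjI exI[of _ "k - 1"]) (auto simp: dist_real_def algebra_simps)
        show ?thesis using yz(6)[of "u - 2 * pi * of_int (k - 1)"] False u k
          unfolding ext'[OF ne] w by (auto simp: dist_real_def algebra_simps)
      qed
    qed (use yz in auto)
  qed
qed

end

section \<open>Construction of an invariant density\<close>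

context circle_contraction
begin

lemma Finv_fixed: "Finv (s + 2 * pi) = s + 2 * pi"
  using fixed shift[of s] by (metis Finv(2))

lemma deriv_Finv_fixed:
  assumes prod: "deriv F n * deriv F s = 1"
  shows "deriv Finv (s + 2 * pi) = deriv F n"
proof -
  have "deriv Finv (s + 2 * pi) = inverse (deriv F s)"
    using DERIV_imp_deriv[OF Finv_deriv[of "s + 2 * pi"]] deriv_shift[of s 1] by (simp add: Finv_fixed)
  then show ?thesis
    using prod pos[of s] inverse_unique[of "deriv F s" "deriv F n"] by (simp add: mult.commute)
qed

text \<open>For the inverse map the roles of the two fixed points are exchanged. The product condition says that
  both contractions have the same multiplier.\<close>
lemma inverse_contraction:
  assumes inj: "inj_on f S1" and prod: "deriv F n * deriv F s = 1"
  shows "circle_contraction (inv_into S1 f) Finv n (s + 2 * pi)"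
proof -
  interpret inv: circle_lift "inv_into S1 f" Finv by (rule inv_lift[OF inj])
  have fix': "F t = t" if "Finv t = t" for t using that by (metis Finv(1))
  note Fs = Finv_fixed
  note ds = deriv_Finv_fixed[OF prod]
  show ?thesis
  proof
    show "n < s + 2 * pi" "s + 2 * pi < n + 2 * pi" "Finv (s + 2 * pi) = s + 2 * pi"
      "deriv Finv (s + 2 * pi) < 1"
      using between attracting by (simp_all add: Fs ds)
    show "Finv n = n" using fixed by (metis Finv(2))
    fix t assume t: "n < t" "t < n + 2 * pi" "Finv t = t"
    then have Ft: "F t = t" using fix' by blast
    have "F (t - 2 * pi) = t - 2 * pi" using shift[of "t - 2 * pi"] Ft by simp
    then show "t = s + 2 * pi"
      using only_fixed[of t] only_fixed[of "t - 2 * pi"] Ft t between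
      by (cases t "s + 2 * pi" rule: linorder_cases) auto
  qed
qed

text \<open>Let \<open>\<phi>\<close> and \<open>a = \<phi>'\<close> linearize \<open>F\<close> around \<open>n\<close>, and let \<open>b\<close> be the derivative of a coordinate linearizing
  the inverse around \<open>s\<close>. The density is \<open>W x y + W y x\<close>, where \<open>W x y\<close> is the invariant product
  \<open>a x * b y\<close> cut off by the invariant quantity \<open>(\<phi> x / \<phi> y)\<^sup>2\<close>.\<close>
theorem density_exists:
  assumes inj: "inj_on f S1" and prod: "deriv F n * deriv F s = 1"
  obtains w where "invariant_density F w"
proof -
  interpret inv: circle_contraction "inv_into S1 f" Finv n "s + 2 * pi"
    by (rule inverse_contraction[OF assms])
  obtain \<phi> a where \<phi>:
    "\<And>t u. cis t = cis u \<Longrightarrow> \<phi> t = \<phi> u" "\<And>t u. cis t = cis u \<Longrightarrow> a t = a u"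
    "\<And>m. times_differentiable_on m \<phi> {t. cis t \<noteq> cis s}"
    "\<And>m. times_differentiable_on m a {t. cis t \<noteq> cis s}"
    "\<And>t. cis t \<noteq> cis s \<Longrightarrow> 0 < a t" "\<And>t. cis t = cis s \<Longrightarrow> a t = 0"
    "\<And>t. \<phi> t = 0 \<longleftrightarrow> cis t = cis n \<or> cis t = cis s"
    "\<And>t. \<phi> (F t) = deriv F n * \<phi> t" "\<And>t. a (F t) * deriv F t = deriv F n * a t"
    "\<And>t M. cis t = cis s \<Longrightarrow> eventually (\<lambda>u. M < \<bar>\<phi> u\<bar>) (at t)"
    using circle_linearization by blast
  obtain b :: "real \<Rightarrow> real" where b:
    "\<And>t u. cis t = cis u \<Longrightarrow> b t = b u"
    "\<And>m. times_differentiable_on m b {t. cis t \<noteq> cis n}"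
    "\<And>t. cis t \<noteq> cis n \<Longrightarrow> 0 < b t" "\<And>t. cis t = cis n \<Longrightarrow> b t = 0"
    "\<And>t. b (Finv t) * deriv Finv t = deriv Finv (s + 2 * pi) * b t"
  proof (rule inv.circle_linearization)
    fix \<phi> a :: "real \<Rightarrow> real"
    assume "\<And>t u. cis t = cis u \<Longrightarrow> a t = a u"
      "\<And>m. times_differentiable_on m a {t. cis t \<noteq> cis n}"
      "\<And>t. cis t \<noteq> cis n \<Longrightarrow> 0 < a t" "\<And>t. cis t = cis n \<Longrightarrow> a t = 0"
      "\<And>t. a (Finv t) * deriv Finv t = deriv Finv (s + 2 * pi) * a t"
    then show thesis by (rule that[of a])
  qed
  let ?A = "{t. cis t \<noteq> cis s}" and ?B = "{t. cis t \<noteq> cis n}"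
  have opn: "open ?A" "open ?B" by (intro open_Collect_neq continuous_intros)+
  note ds = deriv_Finv_fixed[OF prod]
  have bF: "b t = deriv F n * (b (F t) * deriv F t)" for t
  proof -
    have "b t * inverse (deriv F t) = deriv F n * b (F t)"
      using b(5)[of "F t"] DERIV_imp_deriv[OF Finv_deriv[of "F t"]] by (simp add: ds)
    then show ?thesis using pos[of t] by (simp add: divide_simps flip: divide_inverse)
  qed
  \<comment> \<open>At lifts of \<open>s\<close> both \<open>\<phi>\<close> and \<open>a\<close> are \<open>0\<close>, and \<open>b\<close> is \<open>0\<close> at lifts of \<open>n\<close>. With division by
    zero giving \<open>0\<close>, the formula has the right value on all four lines: for \<open>y = s\<close> the quotient is \<open>0\<close>,
    the limit of \<open>\<phi> x / \<phi> y\<close>, and for \<open>x = s\<close> or \<open>y = n\<close> the second factor is \<open>0\<close>.\<close>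
  define W where "W x y = cutoff ((\<phi> x / \<phi> y)\<^sup>2) * (a x * b y)" for x y
  have W_inv: "W (F x) (F y) * deriv F x * deriv F y = W x y" for x y
  proof -
    have "\<phi> (F x) / \<phi> (F y) = \<phi> x / \<phi> y" using pos[of n] by (simp add: \<phi>(8))
    then have "W (F x) (F y) * deriv F x * deriv F y =
        cutoff ((\<phi> x / \<phi> y)\<^sup>2) * ((a (F x) * deriv F x) * (b (F y) * deriv F y))"
      by (simp add: W_def)
    also have "\<dots> = W x y" using bF[of y] by (simp add: \<phi>(9) W_def)
    finally show ?thesis .
  qed
  have "0 \<le> a x" "0 \<le> b x" for x
    using \<phi>(5,6)[of x] b(3,4)[of x] by force+
  then have W_nonneg: "0 \<le> W x y" for x y
    using cutoff_nonneg by (simp add: W_def)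
  \<comment> \<open>Off the four lines the quotients for \<open>W x y\<close> and \<open>W y x\<close> are inverse to each other, so one of
    them is at most \<open>1\<close>. On the lines \<open>x = n\<close> and \<open>y = s\<close> the quotient in \<open>W x y\<close> is \<open>0\<close>;
    the other two lines are their mirror images.\<close>
  have W_pos: "0 < W x y + W y x" if ne: "cis x \<noteq> cis y" for x y
  proof -
    have main: "0 < W x y" if "cis x \<noteq> cis s" "cis y \<noteq> cis n" "(\<phi> x / \<phi> y)\<^sup>2 < 2" for x y
      using that cutoff_pos \<phi>(5) b(3) by (simp add: W_def)
    have half: "0 < W x y" if "cis x \<noteq> cis y" "cis x = cis n \<or> cis y = cis s" for x y
      using that between cis_inj_short[of n s] \<phi>(7)[of x] \<phi>(7)[of y] by (intro main) auto
    have "0 < W x y \<or> 0 < W y x"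
    proof (cases "cis x = cis n \<or> cis y = cis s \<or> cis y = cis n \<or> cis x = cis s")
      case True
      then show ?thesis using half[of x y] half[of y x] ne by auto
    next
      case False
      then have nz: "\<phi> x \<noteq> 0" "\<phi> y \<noteq> 0" using \<phi>(7) by auto
      have "(\<phi> x / \<phi> y)\<^sup>2 \<le> 1 \<or> (\<phi> y / \<phi> x)\<^sup>2 \<le> 1"
        using nz by (auto simp: power_divide divide_simps)
      then show ?thesis using main[of x y] main[of y x] False by auto
    qed
    then show ?thesis using W_nonneg[of x y] W_nonneg[of y x] by auto
  qed
  have Cn_fst: "times_differentiable_on m (\<lambda>p. g (fst p)) (X \<times> Y)"
    and Cn_snd: "times_differentiable_on m (\<lambda>p. h (snd p)) (X \<times> Y)"
    if "open X" "open Y" "times_differentiable_on m g X" "times_differentiable_on m h Y"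
    for m X Y and g h :: "real \<Rightarrow> real"
    using that by (auto intro!: open_Times Cn_linear_precompose[OF bounded_linear_fst that(1) _ _ that(3)]
      Cn_linear_precompose[OF bounded_linear_snd that(2) _ _ that(4)])
  have Cn_zero: "times_differentiable_on m (\<lambda>p. W (fst p) (snd p)) (X \<times> Y)"
    if "open X" "open Y" "\<And>x y. x \<in> X \<Longrightarrow> y \<in> Y \<Longrightarrow> W x y = 0" for m X Y
    by (rule Cn_cong[OF _ _ Cn_const[of m 0]]) (use that in \<open>auto intro: open_Times\<close>)
  have W_zero: "W x y = 0" if "2 * \<bar>\<phi> y\<bar> \<le> \<bar>\<phi> x\<bar>" "\<phi> y \<noteq> 0" for x y
  proof -
    have "2 \<le> \<bar>\<phi> x / \<phi> y\<bar>" using that by (simp add: abs_divide le_divide_eq)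
    from power_mono[OF this, of 2] have "2 \<le> (\<phi> x / \<phi> y)\<^sup>2"
      by (simp del: abs_divide)
    then show ?thesis by (simp add: W_def cutoff_zero)
  qed
  have isCont_\<phi>: "isCont \<phi> t" if "cis t \<noteq> cis s" for t
    using \<phi>(3)[of 0] opn(1) that by (simp add: continuous_on_eq_continuous_at)
  have near: "\<exists>X. open X \<and> x0 \<in> X \<and> X \<subseteq> ?A \<and> (\<forall>x\<in>X. \<bar>\<phi> x - \<phi> x0\<bar> < e)"
    if x0: "cis x0 \<noteq> cis s" "0 < e" for x0 e
  proof -
    obtain d where "0 < d" "\<And>x. dist x x0 < d \<Longrightarrow> dist (\<phi> x) (\<phi> x0) < e"
      using isCont_\<phi>[OF x0(1)] x0(2) unfolding continuous_at_eps_delta by blast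
    then show ?thesis
      using x0 opn(1) by (intro exI[of _ "ball x0 d \<inter> ?A"]) (auto simp: dist_commute dist_real_def)
  qed
  have bounded: "\<exists>X M. open X \<and> x0 \<in> X \<and> X \<subseteq> ?A \<and> 0 < M \<and> (\<forall>x\<in>X. \<bar>\<phi> x\<bar> < M)"
    if x0: "cis x0 \<noteq> cis s" for x0
  proof -
    obtain X where "open X" "x0 \<in> X" "X \<subseteq> ?A" and X: "\<And>x. x \<in> X \<Longrightarrow> \<bar>\<phi> x - \<phi> x0\<bar> < 1"
      using near[OF x0, of 1] by auto
    moreover have "\<bar>\<phi> x\<bar> < \<bar>\<phi> x0\<bar> + 1" if "x \<in> X" for x using X[OF that] by linarith
    ultimately show ?thesis by (intro exI[of _ X] exI[of _ "\<bar>\<phi> x0\<bar> + 1"]) auto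
  qed
  \<comment> \<open>The point \<open>y0\<close> itself is exempt: there \<open>\<phi>\<close> has the conventional value \<open>0\<close>.\<close>
  have far: "\<exists>Y. open Y \<and> y0 \<in> Y \<and> (\<forall>y\<in>Y. y \<noteq> y0 \<longrightarrow> M < \<bar>\<phi> y\<bar>)" if "cis y0 = cis s" for y0 M
    using \<phi>(10)[OF that, of M] unfolding eventually_at_topological by blast
  have Cn_W: "times_differentiable_on m (\<lambda>p. W (fst p) (snd p)) {(x, y). cis x \<noteq> cis y}" for m
  proof (rule Cn_local)
    fix p :: "real \<times> real" assume "p \<in> {(x, y). cis x \<noteq> cis y}"
    then obtain x0 y0 where p: "p = (x0, y0)" "cis x0 \<noteq> cis y0" by auto
    have "\<exists>X Y. open X \<and> open Y \<and> x0 \<in> X \<and> y0 \<in> Y \<and>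
        times_differentiable_on m (\<lambda>p. W (fst p) (snd p)) (X \<times> Y)"
    proof -
      \<comment> \<open>In the generic case the defining formula is smooth. If \<open>y\<close> is near \<open>s\<close> the cutoff is constant; if
        \<open>x\<close> is near \<open>s\<close> or \<open>y\<close> is near \<open>n\<close>, then \<open>W\<close> vanishes.\<close>
      consider (generic) "cis x0 \<noteq> cis s" "cis y0 \<noteq> cis s" "cis y0 \<noteq> cis n"
        | (y_repelling) "cis x0 \<noteq> cis s" "cis y0 = cis s"
        | (x_repelling) "cis x0 = cis s" "cis y0 \<noteq> cis s"
        | (y_attracting) "cis x0 \<noteq> cis s" "cis x0 \<noteq> cis n" "cis y0 = cis n"
        using p(2) by metis
      then show ?thesis
      proof cases
        case generic
        let ?Y = "?A \<inter> ?B"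
        have oY: "open ?Y" using opn by (rule open_Int)
        have tb: "times_differentiable_on m b ?Y" by (rule Cn_subset[OF b(2)]) auto
        have nz: "\<phi> y \<noteq> 0" if "y \<in> ?Y" for y using that by (simp add: \<phi>(7))
        have ti: "times_differentiable_on m (\<lambda>y. inverse (\<phi> y)) ?Y"
          by (rule Cn_compose[OF oY Cn_subset[OF \<phi>(3) Int_lower1] Cn_inverse image_subsetI])
             (drule nz, simp)
        have o: "open (?A \<times> ?Y)" using opn(1) oY by (rule open_Times)
        have "times_differentiable_on m (\<lambda>p. \<phi> (fst p) * inverse (\<phi> (snd p))) (?A \<times> ?Y)"
          by (rule Cn_mult[OF o Cn_fst[OF opn(1) oY \<phi>(3) ti] Cn_snd[OF opn(1) oY \<phi>(3) ti]])
        from Cn_mult[OF o this this]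
        have "times_differentiable_on m (\<lambda>p. (\<phi> (fst p) / \<phi> (snd p))\<^sup>2) (?A \<times> ?Y)"
          by (simp add: power2_eq_square divide_inverse)
        from Cn_compose[OF o this Cn_cutoff]
        have "times_differentiable_on m (\<lambda>p. cutoff ((\<phi> (fst p) / \<phi> (snd p))\<^sup>2)) (?A \<times> ?Y)"
          by simp
        from Cn_mult[OF o this Cn_mult[OF o Cn_fst[OF opn(1) oY \<phi>(4) tb] Cn_snd[OF opn(1) oY \<phi>(4) tb]]]
        have "times_differentiable_on m (\<lambda>p. W (fst p) (snd p)) (?A \<times> ?Y)"
          by (simp add: W_def)
        then show ?thesis using generic opn oY by blast
      next
        case y_repelling
        obtain X M where X: "open X" "x0 \<in> X" "X \<subseteq> ?A" "0 < M" "\<And>x. x \<in> X \<Longrightarrow> \<bar>\<phi> x\<bar> < M"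
          using bounded[OF y_repelling(1)] by blast
        obtain Y where Y: "open Y" "y0 \<in> Y" "\<And>y. y \<in> Y \<Longrightarrow> y \<noteq> y0 \<Longrightarrow> M < \<bar>\<phi> y\<bar>"
          using far[OF y_repelling(2), of M] by blast
        have "cis y0 \<noteq> cis n" using y_repelling(2) between cis_inj_short[of n s] by auto
        have "cutoff 0 = cutoff ((\<phi> x / \<phi> y)\<^sup>2)" if "x \<in> X" "y \<in> Y" for x y
        proof (rule cutoff_const[symmetric], cases "y = y0")
          case True
          moreover have "\<phi> y0 = 0" using \<phi>(7)[of y0] y_repelling(2) by simp
          ultimately show "(\<phi> x / \<phi> y)\<^sup>2 \<le> 1" by simp
        next
          case False
          then have "\<bar>\<phi> x\<bar> < \<bar>\<phi> y\<bar>" using X(5)[OF that(1)] Y(3)[OF that(2)] by simp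
          then show "(\<phi> x / \<phi> y)\<^sup>2 \<le> 1" by (auto simp: power_divide divide_le_eq_1 abs_le_square_iff[symmetric])
        qed
        then have eq: "cutoff 0 * (a x * b y) = W x y" if "x \<in> X" "y \<in> Y" for x y
          using that by (simp add: W_def)
        have oY: "open (Y \<inter> ?B)" using Y opn by auto
        have tb: "times_differentiable_on m b (Y \<inter> ?B)" by (rule Cn_subset[OF b(2) Int_lower2])
        have ta: "times_differentiable_on m a X" by (rule Cn_subset[OF \<phi>(4) X(3)])
        have o: "open (X \<times> (Y \<inter> ?B))" using X(1) oY by (rule open_Times)
        have "times_differentiable_on m (\<lambda>p. W (fst p) (snd p)) (X \<times> (Y \<inter> ?B))"
        proof (rule Cn_cong[OF o])
          show "times_differentiable_on m (\<lambda>p. cutoff 0 * (a (fst p) * b (snd p))) (X \<times> (Y \<inter> ?B))"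
            by (rule Cn_mult[OF o Cn_const Cn_mult[OF o Cn_fst[OF X(1) oY ta tb] Cn_snd[OF X(1) oY ta tb]]])
          show "cutoff 0 * (a (fst p) * b (snd p)) = W (fst p) (snd p)" if "p \<in> X \<times> (Y \<inter> ?B)" for p
            using that by (intro eq) auto
        qed
        then show ?thesis using X(1,2) Y(2) oY \<open>cis y0 \<noteq> cis n\<close> by blast
      next
        case x_repelling
        obtain Y M where Y: "open Y" "y0 \<in> Y" "Y \<subseteq> ?A" "0 < M" "\<And>y. y \<in> Y \<Longrightarrow> \<bar>\<phi> y\<bar> < M"
          using bounded[OF x_repelling(2)] by blast
        obtain X where X: "open X" "x0 \<in> X" "\<And>x. x \<in> X \<Longrightarrow> x \<noteq> x0 \<Longrightarrow> 2 * M < \<bar>\<phi> x\<bar>"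
          using far[OF x_repelling(1), of "2 * M"] by blast
        have "W x y = 0" if "x \<in> X" "y \<in> Y" for x y
        proof -
          consider "x = x0" | "\<phi> y = 0" | "x \<noteq> x0" "\<phi> y \<noteq> 0" by blast
          then show ?thesis
          proof cases
            case 1
            then show ?thesis using \<phi>(6) x_repelling by (simp add: W_def)
          next
            case 2
            then have "cis y = cis n" using \<phi>(7)[of y] Y(3) that by auto
            then show ?thesis using b(4) by (simp add: W_def)
          next
            case 3
            have "2 * \<bar>\<phi> y\<bar> \<le> \<bar>\<phi> x\<bar>" using X(3)[OF that(1) 3(1)] Y(5)[OF that(2)] by simp
            from W_zero[OF this 3(2)] show ?thesis .
          qed
        qed
        from Cn_zero[OF X(1) Y(1) this] show ?thesis using X(1,2) Y(1,2) by blast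
      next
        case y_attracting
        have nz: "\<phi> x0 \<noteq> 0" "\<phi> y0 = 0" "cis y0 \<noteq> cis s"
          using y_attracting between cis_inj_short[of n s] by (auto simp: \<phi>(7))
        then have e: "0 < \<bar>\<phi> x0\<bar> / 4" by simp
        obtain X where X: "open X" "x0 \<in> X" "\<And>x. x \<in> X \<Longrightarrow> \<bar>\<phi> x - \<phi> x0\<bar> < \<bar>\<phi> x0\<bar> / 4"
          using near[OF y_attracting(1) e] by blast
        obtain Y where Y: "open Y" "y0 \<in> Y" "Y \<subseteq> ?A" "\<And>y. y \<in> Y \<Longrightarrow> \<bar>\<phi> y - \<phi> y0\<bar> < \<bar>\<phi> x0\<bar> / 4"
          using near[OF nz(3) e] by blast
        have "W x y = 0" if "x \<in> X" "y \<in> Y" for x y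
        proof (cases "\<phi> y = 0")
          case True
          then have "cis y = cis n" using \<phi>(7)[of y] Y(3) that by auto
          then show ?thesis using b(4) by (simp add: W_def)
        next
          case False
          have "2 * \<bar>\<phi> y\<bar> \<le> \<bar>\<phi> x\<bar>" using X(3)[OF that(1)] Y(4)[OF that(2)] nz(2) by linarith
          from W_zero[OF this False] show ?thesis .
        qed
        from Cn_zero[OF X(1) Y(1) this] show ?thesis using X(1,2) Y(1,2) by blast
      qed
    qed
    then obtain X Y where XY: "open X" "open Y" "x0 \<in> X" "y0 \<in> Y"
      "times_differentiable_on m (\<lambda>p. W (fst p) (snd p)) (X \<times> Y)" by blast
    then show "\<exists>V. open V \<and> p \<in> V \<and> times_differentiable_on m (\<lambda>p. W (fst p) (snd p)) V"
      by (intro exI[of _ "X \<times> Y"]) (simp add: p(1) open_Times)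
  qed
  have off: "open {(x, y). cis x \<noteq> cis y}" (is "open ?O")
    unfolding case_prod_beta by (intro open_Collect_neq continuous_intros)
  have "times_differentiable_on m (\<lambda>p. W (fst (snd p, fst p)) (snd (snd p, fst p))) ?O" for m
    by (rule Cn_linear_precompose[OF _ off off _ Cn_W])
       (auto intro!: bounded_linear_Pair bounded_linear_fst bounded_linear_snd)
  then have sum: "times_differentiable_on m (\<lambda>p. W (fst p) (snd p) + W (snd p) (fst p)) ?O" for m
    by (intro Cn_add off Cn_W) simp
  have "invariant_density F (\<lambda>x y. W x y + W y x)"
    unfolding invariant_density_def
  proof (intro conjI allI impI)
    fix x y x' y' assume "cis x = cis x'" "cis y = cis y'"
    then show "W x y + W y x = W x' y' + W y' x'"
      using \<phi>(1)[of x x'] \<phi>(1)[of y y'] \<phi>(2)[of x x'] \<phi>(2)[of y y'] b(1)[of x x'] b(1)[of y y']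
      by (simp add: W_def)
  next
    fix x y assume ne: "cis x \<noteq> cis y"
    show "W x y + W y x \<noteq> 0" using W_pos[OF ne] by simp
    show "(W (F x) (F y) + W (F y) (F x)) * deriv F x * deriv F y = W x y + W y x"
      using W_inv[of x y] W_inv[of y x] by (simp add: algebra_simps)
  qed (use sum in \<open>simp add: case_prod_beta'\<close>)
  then show ?thesis by (rule that)
qed

end

section \<open>Multipliers of area-preserving maps\<close>

context circle_lift
begin

text \<open>The diagonal action fixes \<open>(s, t)\<close>, so the nonzero value of the density there cancels from the
  transformation rule.\<close>
lemma density_multiplier_product:
  assumes w: "invariant_density F w" and st: "cis s \<noteq> cis t" "F s = s" "F t = t"
  shows "deriv F s * deriv F t = 1"
proof -
  have "w s t \<noteq> 0" "w (F s) (F t) * deriv F s * deriv F t = w s t"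
    using w st(1) unfolding invariant_density_def by blast+
  then show ?thesis using st by (simp add: mult.assoc)
qed

text \<open>If the multiplier at \<open>s\<close> is \<open>1\<close>, then \<open>w u s du\<close> is invariant under \<open>F\<close>. Its primitive \<open>P\<close>
  satisfies \<open>P (F u) = P u\<close>, first up to a constant and then exactly because of the fixed point \<open>n\<close>;
  as \<open>P\<close> is injective by Rolle's theorem, \<open>F\<close> would fix every point.\<close>
lemma density_not_neutral:
  assumes w: "invariant_density F w" and s: "F s = s" and n: "F n = n" "s < n" "n < s + 2 * pi"
    and x: "s < x" "x < s + 2 * pi" "F x \<noteq> x"
  shows "deriv F s \<noteq> 1"
proof
  assume neutral: "deriv F s = 1"
  let ?I = "{s<..<s + 2 * pi}"
  have ne: "cis u \<noteq> cis s" if "u \<in> ?I" for u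
    using that cis_inj_short[of u s] by auto
  have w': "w u s \<noteq> 0" "w (F u) s * deriv F u = w u s" if "u \<in> ?I" for u
  proof -
    have "w u s \<noteq> 0 \<and> w (F u) (F s) * deriv F u * deriv F s = w u s"
      using w ne[OF that] unfolding invariant_density_def by blast
    then show "w u s \<noteq> 0" "w (F u) s * deriv F u = w u s" by (simp_all add: s neutral)
  qed
  have F_I: "F u \<in> ?I" if "u \<in> ?I" for u
    using that strict_mono_less[OF smono, of s u] strict_mono_less[OF smono, of u "s + 2 * pi"] s shift[of s]
    by auto
  have c: "continuous_on {(s, t). cis s \<noteq> cis t} (\<lambda>(s, t). w s t)"
    using w Cn_continuous unfolding invariant_density_def by blast
  have "continuous_on ?I (\<lambda>u. (u, s))" by (intro continuous_intros)
  from continuous_on_compose2[OF c this] have "continuous_on ?I (\<lambda>u. w u s)"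
    using ne by (simp add: image_subset_iff)
  then have "\<exists>P. \<forall>u. ereal s < ereal u \<longrightarrow> ereal u < ereal (s + 2 * pi) \<longrightarrow>
      (P has_vector_derivative w u s) (at u)"
    by (intro einterval_antiderivative) (auto simp: continuous_on_eq_continuous_at)
  then obtain P where P: "\<And>u. u \<in> ?I \<Longrightarrow> (P has_real_derivative w u s) (at u)"
    by (auto simp: has_real_derivative_iff_has_vector_derivative)
  have "((\<lambda>u. P (F u) - P u) has_real_derivative 0) (at u)" if "u \<in> ?I" for u
    using DERIV_diff[OF DERIV_chain2[OF P[OF F_I[OF that]] deriv] P[OF that]] w'(2)[OF that] by simp
  then have "\<exists>d. \<forall>u\<in>?I. P (F u) - P u = d"
    by (intro has_field_derivative_zero_constant) (auto intro: has_field_derivative_at_within)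
  then obtain d where d: "\<And>u. u \<in> ?I \<Longrightarrow> P (F u) - P u = d" by blast
  have "d = 0" using d[of n] n by simp
  then have inv: "P (F x) = P x" using d[of x] x by simp
  have no: False if uv: "u < v" "u \<in> ?I" "v \<in> ?I" "P u = P v" for u v
  proof -
    have "continuous_on {u..v} P"
      using uv by (intro continuous_at_imp_continuous_on ballI DERIV_isCont[OF P]) auto
    moreover have "P differentiable (at z)" if "u < z" "z < v" for z
      using P[of z] that uv(2,3) by (auto simp: real_differentiable_def)
    ultimately obtain z where "u < z" "z < v" "DERIV P z :> 0"
      using Rolle[of u v P] uv(1,4) by blast
    then show False using DERIV_unique[OF P[of z]] w'(1)[of z] uv by force
  qed
  have xI: "x \<in> ?I" using x by simp
  have "x < F x \<or> F x < x" using x(3) by linarith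
  then show False
    using no[OF _ xI F_I[OF xI] inv[symmetric]] no[OF _ F_I[OF xI] xI inv] by blast
qed

end

section \<open>Powers of a diffeomorphism\<close>

lemma circle_lift_one: "circle_lift (\<lambda>x\<in>S1. x) (\<lambda>t. t)"
  by standard (auto intro: Cn_bounded_linear_id bounded_linear_ident)

lemma circle_lift_compose:
  assumes "circle_lift f F" "circle_lift g G" shows "circle_lift (compose S1 g f) (\<lambda>t. G (F t))"
proof -
  interpret f: circle_lift f F by fact
  interpret g: circle_lift g G by fact
  have "((\<lambda>t. G (F t)) has_real_derivative deriv G (F t) * deriv F t) (at t)" for t
    by (rule DERIV_chain2[OF g.deriv f.deriv])
  from DERIV_imp_deriv[OF this] show ?thesis
    by unfold_locales
       (auto simp: compose_def f.lift g.lift f.pos g.pos f.shift g.shift intro: Cn_compose[OF _ f.smooth g.smooth])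
qed

text \<open>A lift with one fixed point preserves each interval \<open>[s + 2 * pi * k, s + 2 * pi * (k + 1))\<close>, so it
  cannot move a lift of a fixed point to a different one.\<close>
lemma (in circle_lift) fixed_iff:
  assumes "F s = s" shows "cis (F t) = cis t \<longleftrightarrow> F t = t"
proof
  assume c: "cis (F t) = cis t"
  obtain k :: int where k: "t = wrap s t + 2 * pi * k" by (rule wrap_shift)
  have "cis (F (wrap s t)) = cis (wrap s t)" using c cis_F_iff[of "wrap s t" t] by simp
  moreover have "s \<le> F (wrap s t)" "F (wrap s t) < s + 2 * pi"
    using strict_mono_less_eq[OF smono, of s "wrap s t"] strict_mono_less[OF smono, of "wrap s t" "s + 2 * pi"]
      wrap_range[of s t] assms shift[of s] by auto
  ultimately have "F (wrap s t) = wrap s t"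
    using cis_inj_short[of "F (wrap s t)" "wrap s t"] wrap_range[of s t] by auto
  then show "F t = t" using shift_int[of "wrap s t" k] k by simp
qed simp

lemma (in circle_lift) fixed_points_lift:
  assumes "F s = s" shows "fixed_points f = cis ` {t. F t = t}"
proof -
  have "x \<in> fixed_points f \<longleftrightarrow> (\<exists>t. F t = t \<and> x = cis t)" for x
  proof
    assume "x \<in> fixed_points f"
    then have "x = cis (Arg x)" "f x = x" using sphere_cis by (auto simp: fixed_points_def)
    then have "F (Arg x) = Arg x" using fixed_iff[OF assms, of "Arg x"] lift[of "Arg x"] by simp
    then show "\<exists>t. F t = t \<and> x = cis t" using \<open>x = cis (Arg x)\<close> by blast
  qed (auto simp: fixed_points_def lift)
  then show ?thesis by blast
qed

text \<open>If \<open>x\<close> moves, monotonicity makes all further iterates move to the same side.\<close>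
lemma strict_mono_funpow_fixed:
  assumes "strict_mono (F :: real \<Rightarrow> real)" "0 < m" "(F ^^ m) x = x" shows "F x = x"
proof (rule ccontr)
  assume ne: "F x \<noteq> x"
  obtain k where m: "m = Suc k" using assms(2) by (cases m) auto
  have up: "x \<le> (F ^^ k) x" if "x < F x" for k
  proof (induction k)
    case (Suc k)
    then show ?case using that strict_mono_less_eq[OF assms(1), of x "(F ^^ k) x"] by simp
  qed simp
  have down: "(F ^^ k) x \<le> x" if "F x < x" for k
  proof (induction k)
    case (Suc k)
    then show ?case using that strict_mono_less_eq[OF assms(1), of "(F ^^ k) x" x] by simp
  qed simp
  have step: "(F ^^ Suc k) x = F ((F ^^ k) x)" by simp
  show False
    using ne assms(3) up[of k] down[of k] step strict_mono_less_eq[OF assms(1), of x "(F ^^ k) x"]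
      strict_mono_less_eq[OF assms(1), of "(F ^^ k) x" x]
    by (cases x "F x" rule: linorder_cases) (auto simp: m)
qed

text \<open>Positive powers are lifted by iterates of \<open>F\<close>, negative ones by their inverses. At a fixed
  point the chain rule multiplies the derivative by the same number at each step.\<close>
lemma (in circle_lift) power_lift:
  assumes f: "f \<in> Bij S1"
  obtains L where "circle_lift (generated_rep f m) L"
    "\<And>t. F t = t \<Longrightarrow> L t = t" "\<And>t. m \<noteq> 0 \<Longrightarrow> L t = t \<Longrightarrow> F t = t"
    "\<And>t. F t = t \<Longrightarrow> deriv L t = deriv F t powi m"
proof -
  interpret G: group "BijGroup S1" by (rule group_BijGroup)
  have fG: "f \<in> carrier (BijGroup S1)" using f by (simp add: BijGroup_def)
  have carrier: "carrier (BijGroup S1) = Bij S1" by (simp add: BijGroup_def)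
  have mult: "g \<otimes>\<^bsub>BijGroup S1\<^esub> h = compose S1 g h" if "g \<in> Bij S1" "h \<in> Bij S1" for g h
    using that by (simp add: BijGroup_def)
  have nat: "circle_lift (f [^]\<^bsub>BijGroup S1\<^esub> k) (F ^^ k)" for k :: nat
  proof (induction k)
    case 0
    then show ?case using circle_lift_one by (simp add: BijGroup_def id_def restrict_def)
  next
    case (Suc k)
    have "f [^]\<^bsub>BijGroup S1\<^esub> k \<in> Bij S1"
      using G.nat_pow_closed[OF fG, of k] by (simp only: carrier)
    then have "f [^]\<^bsub>BijGroup S1\<^esub> Suc k = compose S1 (f [^]\<^bsub>BijGroup S1\<^esub> k) f"
      using f by (simp only: nat_pow_Suc mult)
    moreover have "(\<lambda>t. (F ^^ k) (F t)) = F ^^ Suc k" by (simp add: fun_eq_iff funpow_swap1)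
    ultimately show ?case using circle_lift_compose[OF circle_lift_axioms Suc] by (simp add: o_def)
  qed
  have fixed: "(F ^^ k) t = t" if "F t = t" for k t by (induction k) (use that in auto)
  have der: "((F ^^ k) has_real_derivative deriv F t ^ k) (at t)" if "F t = t" for k t
  proof (induction k)
    case (Suc k)
    have "(F has_real_derivative deriv F t) (at ((F ^^ k) t))" using deriv[of t] fixed[OF that] by simp
    from DERIV_chain[OF this Suc] show ?case by (simp add: o_def)
  qed (simp add: id_def)
  show ?thesis
  proof (cases "0 \<le> m")
    case True
    then obtain k where m: "m = int k" using nonneg_int_cases by blast
    show ?thesis
    proof (rule that[of "F ^^ k"])
      show "circle_lift (generated_rep f m) (F ^^ k)" using nat by (simp add: generated_rep_def m int_pow_int)
      show "deriv (F ^^ k) t = deriv F t powi m" if "F t = t" for t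
        using DERIV_imp_deriv[OF der[OF that]] by (simp add: m)
    qed (use fixed strict_mono_funpow_fixed[OF smono] m in auto)
  next
    case False
    then obtain k where m: "m = - int k" "0 < k" by (metis neg_int_cases not_le)
    let ?g = "f [^]\<^bsub>BijGroup S1\<^esub> k"
    interpret g: circle_lift ?g "F ^^ k" by (rule nat)
    have gB: "?g \<in> Bij S1" using G.nat_pow_closed[OF fG, of k] by (simp only: carrier)
    have "inj_on ?g S1" using gB by (simp add: Bij_def bij_betw_def)
    then have "circle_lift (inv_into S1 ?g) (inv_into UNIV (F ^^ k))" by (rule g.inv_lift)
    then have "circle_lift (\<lambda>x\<in>S1. inv_into S1 ?g x) (inv_into UNIV (F ^^ k))"
      by (simp add: circle_lift_def)
    moreover have "generated_rep f m = (\<lambda>x\<in>S1. inv_into S1 ?g x)"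
      using G.int_pow_neg_int[OF fG, of k] inv_BijGroup[OF gB] by (simp add: generated_rep_def m)
    ultimately have L: "circle_lift (generated_rep f m) (inv_into UNIV (F ^^ k))" by simp
    have Lfix: "inv_into UNIV (F ^^ k) t = t" if "F t = t" for t using fixed[OF that] g.Finv(2) by metis
    show ?thesis
    proof (rule that[OF L Lfix])
      show "F t = t" if "inv_into UNIV (F ^^ k) t = t" for t
        using that g.Finv(1)[of t] strict_mono_funpow_fixed[OF smono m(2)] by simp
      show "deriv (inv_into UNIV (F ^^ k)) t = deriv F t powi m" if "F t = t" for t
        using DERIV_imp_deriv[OF g.Finv_deriv[of t]] Lfix[OF that] DERIV_imp_deriv[OF der[OF that]]
        by (simp add: m power_int_minus)
    qed
  qed
qed

lemma powi_pos_eq_1_iff: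
  fixes a :: real assumes "0 < a" "m \<noteq> 0" shows "a powi m = 1 \<longleftrightarrow> a = 1"
proof -
  have "a ^ k = 1 \<longleftrightarrow> a = 1" if "0 < k" for k
    using power_eq_iff_eq_base[of k a 1] that assms(1) by simp
  then show ?thesis using assms(2) by (cases m rule: int_cases2) (auto simp: power_int_minus)
qed

section \<open>The equivalence\<close>

text \<open>The angles of the two fixed points can be chosen within one turn, and the lift that fixes the first
  then fixes the second.\<close>
lemma fixed_points_lifts:
  assumes f: "f \<in> Diff_S1" and NS: "N \<noteq> S" "fixed_points f = {N, S}"
  obtains F s n where "circle_lift f F" "s < n" "n < s + 2 * pi" "F s = s" "F n = n"
    "N = cis n" "S = cis s" "\<And>t. s < t \<Longrightarrow> t < s + 2 * pi \<Longrightarrow> F t = t \<Longrightarrow> t = n"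
    "circle_deriv f N = deriv F n" "circle_deriv f S = deriv F s"
proof -
  define s n where "s = Arg S" and "n = wrap s (Arg N)"
  have "N \<in> S1" "S \<in> S1" and fix_S: "f N = N" "f S = S" using NS by (auto simp: fixed_points_def)
  then have S: "S = cis s" and N: "N = cis n" using sphere_cis by (simp_all add: s_def n_def)
  have "n \<noteq> s" using S N NS(1) by blast
  then have sn: "s < n" "n < s + 2 * pi"
    using wrap_range[of s "Arg N"] unfolding n_def by linarith+
  obtain F where F: "circle_lift f F" "F s = s" using Diff_S1_lift[OF f, of s] fix_S S by auto
  interpret circle_lift f F by (rule F(1))
  have n: "F n = n" using fixed_iff[OF F(2), of n] fix_S N lift by simp
  show ?thesis
  proof (rule that[OF F(1) sn F(2) n N S])
    fix t assume t: "s < t" "t < s + 2 * pi" "F t = t"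
    then have "cis t \<in> {N, S}" using fixed_points_lift[OF F(2)] NS(2) by auto
    then show "t = n" using cis_inj_short[of t n] cis_inj_short[of t s] t sn N S by auto
  qed (simp_all add: N S circle_deriv_lift[OF lift deriv])
qed

lemma area_preserving_if_attracting:
  assumes f: "f \<in> Diff_S1" and NS: "N \<noteq> S" "fixed_points f = {N, S}"
    and "circle_deriv f N * circle_deriv f S = 1" "circle_deriv f N < 1"
  shows "area_preserving f"
proof -
  obtain F s n where F: "circle_lift f F" "s < n" "n < s + 2 * pi" "F s = s" "F n = n"
    "N = cis n" "S = cis s" "\<And>t. s < t \<Longrightarrow> t < s + 2 * pi \<Longrightarrow> F t = t \<Longrightarrow> t = n"
    "circle_deriv f N = deriv F n" "circle_deriv f S = deriv F s"
    by (rule fixed_points_lifts[OF f NS]) (rule that; assumption)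
  interpret circle_contraction f F s n
  proof (intro circle_contraction.intro circle_contraction_axioms.intro)
    show "deriv F n < 1" using F(9) assms(5) by simp
  qed (rule F | assumption)+
  have inj: "inj_on f S1" using f by (simp add: Diff_S1_def Bij_def bij_betw_def)
  have prod: "deriv F n * deriv F s = 1" using F(9,10) assms(4) by simp
  obtain w where "invariant_density F w" using density_exists[OF inj prod] by blast
  then show ?thesis by (rule density_imp_area_preserving)
qed

lemma area_preserving_multipliers:
  assumes f: "f \<in> Diff_S1" and NS: "N \<noteq> S" "fixed_points f = {N, S}"
    and "area_preserving f"
  shows "circle_deriv f N * circle_deriv f S = 1 \<and> circle_deriv f N \<noteq> 1"
proof -
  obtain F s n where F: "circle_lift f F" "s < n" "n < s + 2 * pi" "F s = s" "F n = n"
    "N = cis n" "S = cis s" "\<And>t. s < t \<Longrightarrow> t < s + 2 * pi \<Longrightarrow> F t = t \<Longrightarrow> t = n"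
    "circle_deriv f N = deriv F n" "circle_deriv f S = deriv F s"
    by (rule fixed_points_lifts[OF f NS]) (rule that; assumption)
  interpret circle_lift f F by (rule F(1))
  obtain w where w: "invariant_density F w" using area_preserving_imp_density assms(4) by blast
  have prod: "deriv F n * deriv F s = 1"
    using density_multiplier_product[OF w _ F(5,4)] NS(1) F(6,7) by blast
  have "F ((s + n) / 2) \<noteq> (s + n) / 2"
    using F(2,3) F(8)[of "(s + n) / 2"] by auto
  then have "deriv F s \<noteq> 1"
    using F(2,3) by (intro density_not_neutral[OF w F(4,5,2,3), where x="(s + n) / 2"]) auto
  then show ?thesis using prod F(9,10) by auto
qed

text \<open>The generator gives one direction. For the other, a power \<open>m \<noteq> 0\<close> has the fixed points of \<open>f\<close>, with the
  \<open>m\<close>-th powers of its multipliers; the trivial power has more than two.\<close>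
lemma spectrally_moebius_like_iff:
  assumes f: "f \<in> Diff_S1" and NS: "N \<noteq> S" "fixed_points f = {N, S}"
  shows "spectrally_moebius_like integer_group (generated_rep f) \<longleftrightarrow>
      circle_deriv f N * circle_deriv f S = 1 \<and> circle_deriv f N \<noteq> 1" (is "?L \<longleftrightarrow> ?R")
proof
  have B: "f \<in> Bij S1" using f by (simp add: Diff_S1_def)
  interpret G: group "BijGroup S1" by (rule group_BijGroup)
  have "f \<in> carrier (BijGroup S1)" using B by (simp add: BijGroup_def)
  then have rep1: "generated_rep f 1 = f" by (simp add: generated_rep_def)
  show ?R if ?L
    using that NS rep1 unfolding spectrally_moebius_like_def by (metis UNIV_I carrier_integer_group)
  assume R: ?R
  obtain F s n where F: "circle_lift f F" "s < n" "n < s + 2 * pi" "F s = s" "F n = n"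
    "N = cis n" "S = cis s" "\<And>t. s < t \<Longrightarrow> t < s + 2 * pi \<Longrightarrow> F t = t \<Longrightarrow> t = n"
    "circle_deriv f N = deriv F n" "circle_deriv f S = deriv F s"
    by (rule fixed_points_lifts[OF f NS]) (rule that; assumption)
  interpret circle_lift f F by (rule F(1))
  have power: "fixed_points (generated_rep f m) = {N, S}"
    "circle_deriv (generated_rep f m) N = deriv F n powi m"
    "circle_deriv (generated_rep f m) S = deriv F s powi m" if "m \<noteq> 0" for m
  proof -
    obtain L where L: "circle_lift (generated_rep f m) L"
      "\<And>t. F t = t \<Longrightarrow> L t = t" "\<And>t. m \<noteq> 0 \<Longrightarrow> L t = t \<Longrightarrow> F t = t"
      "\<And>t. F t = t \<Longrightarrow> deriv L t = deriv F t powi m"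
      using power_lift[OF B, of m] by blast
    interpret L: circle_lift "generated_rep f m" L by (rule L(1))
    have "{t. L t = t} = {t. F t = t}" using L(2,3) that by blast
    then show "fixed_points (generated_rep f m) = {N, S}"
      using L.fixed_points_lift[OF L(2)[OF F(4)]] fixed_points_lift[OF F(4)] NS(2) by simp
    show "circle_deriv (generated_rep f m) N = deriv F n powi m"
      "circle_deriv (generated_rep f m) S = deriv F s powi m"
      using L(4) F(4-7) by (simp_all add: circle_deriv_lift[OF L.lift L.deriv])
  qed
  have ne: "deriv F n \<noteq> 1" "deriv F s \<noteq> 1" and prod: "deriv F n * deriv F s = 1" using R F(9,10) by auto
  show ?L
    unfolding spectrally_moebius_like_def
  proof (intro conjI ballI allI impI)
    fix m :: int assume "m \<noteq> \<one>\<^bsub>integer_group\<^esub>"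
    then have "m \<noteq> 0" by simp
    then show "finite (fixed_points (generated_rep f m))" "card (fixed_points (generated_rep f m)) \<le> 2"
      using NS(1) by (simp_all add: power)
  next
    fix m :: int and A B assume AB: "A \<noteq> B \<and> fixed_points (generated_rep f m) = {A, B}"
    have "m \<noteq> 0"
    proof
      assume m: "m = 0"
      have "fixed_points (generated_rep f m) = S1"
        by (auto simp: m generated_rep_def BijGroup_def fixed_points_def)
      then have "{1, -1, \<i>} \<subseteq> {A, B}" using AB by auto
      then have "card {1, -1, \<i>} \<le> card {A, B}" by (intro card_mono) auto
      moreover have "card {1, -1, \<i>} = 3" by (simp add: complex_eq_iff)
      ultimately show False by (simp add: card_insert_if split: if_splits)
    qed
    then have "{A, B} = {N, S}" using AB power(1) by simp
    then have AB: "A = N \<and> B = S \<or> A = S \<and> B = N" by (simp add: doubleton_eq_iff)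
    have "deriv F n powi m * deriv F s powi m = 1"
      by (simp add: prod flip: power_int_mult_distrib)
    then show "circle_deriv (generated_rep f m) A * circle_deriv (generated_rep f m) B = 1"
      using AB power(2,3)[OF \<open>m \<noteq> 0\<close>] mult.commute by metis
    have "deriv F n powi m \<noteq> 1" "deriv F s powi m \<noteq> 1"
      using ne powi_pos_eq_1_iff[OF pos \<open>m \<noteq> 0\<close>] by simp_all
    then show "circle_deriv (generated_rep f m) A \<noteq> 1"
      using AB power(2,3)[OF \<open>m \<noteq> 0\<close>] by metis
  qed
qed

theorem proposition1p7:
  fixes f :: "complex \<Rightarrow> complex" and N S :: complex
  assumes "f \<in> Diff_S1"
    and "N \<noteq> S"
    and "fixed_points f = {N, S}"
  shows "(area_preserving f \<longleftrightarrow> spectrally_moebius_like integer_group (generated_rep f)) \<and>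
         (spectrally_moebius_like integer_group (generated_rep f) \<longleftrightarrow>
            circle_deriv f N * circle_deriv f S = 1 \<and> circle_deriv f N \<noteq> 1)"
proof -
  \<comment> \<open>The hypotheses are symmetric in \<open>N\<close> and \<open>S\<close>, and one of the two multipliers is less than \<open>1\<close>.\<close>
  have "area_preserving f"
    if m: "circle_deriv f N * circle_deriv f S = 1" "circle_deriv f N \<noteq> 1"
  proof (cases "circle_deriv f N < 1")
    case True
    then show ?thesis using area_preserving_if_attracting[OF assms m(1)] by blast
  next
    case False
    have "circle_deriv f S < 1"
      using False m(2) inverse_unique[OF m(1)] inverse_less_1_iff[of "circle_deriv f N"] by simp
    moreover have "fixed_points f = {S, N}" using assms(3) by (simp add: insert_commute)
    ultimately show ?thesis
      using area_preserving_if_attracting[OF assms(1) assms(2)[symmetric]] m(1) by (simp add: mult.commute)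
  qed
  then show ?thesis
    using area_preserving_multipliers[OF assms] spectrally_moebius_like_iff[OF assms] by blast
qed

end
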